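(* Let $N\ge 2$, let $\mathcal{L}=\partial_x^N+u_{N-2}(x)\partial_x^{N-2}+\cdots+u_0(x)$, and let $\kappa_N=(-1)^{N/2+1}$ if $N$ is even and $\kappa_N\in\{1,-1\}$ (fixed) if $N$ is odd. Let $H_k^j(x,y)$ ($k\in\mathbb{N}$, $0\le j\le N-2$) be the Hadamard's coefficients of the heat equation $\partial_t v=\kappa_N\mathcal{L}v$, and let $\omega_n(x,y)$ ($n\ge 0$) be the coefficients of $\mathfrak{R}(\mathcal{L})=\Psi(x,z)\Psi^*(y,z)=\left(\sum_{n\ge0}\omega_n(x,y)z^{-n}\right)e^{(x-y)z}$. Put $$D_N=-\partial_x^{-N+1}\cdot(x-y)=-(x-y)\partial_x^{-N+1}+(N-1)\partial_x^{-N},$$ $$H(x,y,\partial_x)=1+\sum_{j=0}^{N-2}\sum_{k=1}^{\infty}H_k^j(x,y)\frac{\kappa_N^k}{N^k}\,\partial_x^jD_N^k .$$ If the operator $H(x,y,\partial_x)$ is expanded in powers of $\partial_x^{-1}$ (with all powers of $\partial_x^{-1}$ on the right), then $$H(x,y,\partial_x)=\sum_{n=0}^{\infty}\omega_n(x,y)\,\partial_x^{-n}.$$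
   Context: The coefficients $u_j$ are smooth functions of $x$. Airy-type function: $A_N(z)=A_N(z;\kappa_N)=\frac{1}{2\pi}\int_{-\infty}^{\infty}e^{iz\xi+\kappa_N(i\xi)^N}d\xi$; for $N$ odd this is understood as $\frac{1}{2\pi i}\int_{c-i\infty}^{c+i\infty}e^{z\xi+\kappa_N\xi^N}d\xi$ with any $c>0$ if $\kappa_N=(-1)^{(N+1)/2}$ and any $c<0$ if $\kappa_N=(-1)^{(N-1)/2}$. It is entire and satisfies $A_N^{(N-1)}(z)=-\frac{\kappa_N}{N}zA_N(z)$. Heat kernel and Hadamard's coefficients: the heat kernel of $\partial_tv=\kappa_N\mathcal{L}v$ is the formal expansion ($t>0$) $$\mathcal{H}(x,y,t)=\frac{1}{\sqrt[N]{t}}A_N\left(\frac{x-y}{\sqrt[N]{t}}\right)+\sum_{j=0}^{N-2}\frac{1}{\sqrt[N]{t^{j+1}}}A_N^{(j)}\left(\frac{x-y}{\sqrt[N]{t}}\right)\sum_{k=1}^{\infty}H_k^j(x,y)t^k,$$ where the $H_k^j$ are uniquely determined by: (a) for fixed $y$, $\mathcal{H}(x,y,t)$ formally solves $\partial_tv=\kappa_N\mathcal{L}v$ (i.e. after substitution and elimination of $A_N^{(N-1)}$ and higher derivatives by the Airy equation, the coefficients of each $t^{-(j+1)/N}A_N^{(j)}\left(\frac{x-y}{\sqrt[N]{t}}\right)t^k$, $0\le j\le N-2$, on both sides coincide); (b) the $H_k^j(x,y)$ are smooth in a neighborhood of the diagonal $y=x$. Formal pseudo-differential operators are series $\sum_{i\le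 m}r_i(x)\partial_x^i$, multiplied via $\partial_x^k\cdot r(x)=\sum_{i\ge0}\binom{k}{i}r^{(i)}(x)\partial_x^{k-i}$, $k\in\mathbb{Z}$. The adjoint $^*$ is the antiautomorphism with $\partial_x^*=-\partial_x$ fixing functions. Write $\mathcal{L}=S\partial_x^NS^{-1}$ with $S=\sum_{k\ge0}\psi_k(x)\partial_x^{-k}$, $\psi_0=1$ ($S$ is unique up to right multiplication by a constant-coefficient operator $1+\sum_{j\ge1}c_j\partial_x^{-j}$). With $\partial_x^je^{xz}=z^je^{xz}$ for all $j\in\mathbb{Z}$ (and similarly for $e^{-xz}$), put $\Psi(x,z)=Se^{xz}=\left(\sum_k\psi_k(x)z^{-k}\right)e^{xz}$ and $\Psi^*(x,z)=(S^* )^{-1}e^{-xz}=\left(\sum_k\psi_k^*(x)z^{-k}\right)e^{-xz}$. The product $\Psi(x,z)\Psi^*(y,z)$, hence each $\omega_n(x,y)$, depends only on $\mathcal{L}$. Convention: in $H(x,y,\partial_x)$ the variables $x$ and $y$ are treated as independent until all powers of $\partial_x^{-1}$ have been pulled to the right (in particular when later setting $y=x$). *)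

theory Defs
  imports "HOL-Analysis.Analysis" "HOL-Library.Groups_Big_Fun"
begin

section \<open>Smooth functions\<close>

fun times_diff_on :: "nat \<Rightarrow> 'a::real_normed_vector set \<Rightarrow> ('a \<Rightarrow> 'b::real_normed_vector) \<Rightarrow> bool" where
  "times_diff_on 0 U f \<longleftrightarrow> continuous_on U f"
| "times_diff_on (Suc n) U f \<longleftrightarrow>
     (\<forall>p\<in>U. f differentiable (at p)) \<and>
     (\<forall>v. times_diff_on n U (\<lambda>p. frechet_derivative f (at p) v))"

text \<open>Meant for open \<open>U\<close>.\<close>
definition smooth_on :: "'a::real_normed_vector set \<Rightarrow> ('a \<Rightarrow> 'b::real_normed_vector) \<Rightarrow> bool" where
  "smooth_on U f \<longleftrightarrow> (\<forall>n. times_diff_on n U f)"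

definition D1 :: "(real \<Rightarrow> complex) \<Rightarrow> real \<Rightarrow> complex" where
  "D1 f x = vector_derivative f (at x)"


section \<open>Formal pseudo-differential operators\<close>

text \<open>
  The series \<open>\<Sum>\<^sub>i P\<^sub>i(x) \<partial>\<^sup>i\<close> is represented by \<open>P :: int \<Rightarrow> real \<Rightarrow> complex\<close>. Coefficients matter only on
  an open interval \<open>I\<close>, and \<open>pdo_on I\<close> requires them to be smooth there and the order to be bounded
  above. Every \<open>Sum_any\<close> below then has finite support at each point of \<open>I\<close>.
\<close>

type_synonym pdo = "int \<Rightarrow> real \<Rightarrow> complex"

definition pdo_on :: "real set \<Rightarrow> pdo \<Rightarrow> bool" where
  "pdo_on I P \<longleftrightarrow> (\<forall>i. smooth_on I (P i)) \<and> (\<exists>m. \<forall>i>m. \<forall>x\<in>I. P i x = 0)"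

definition pdo_eq_on :: "real set \<Rightarrow> pdo \<Rightarrow> pdo \<Rightarrow> bool" where
  "pdo_eq_on I P Q \<longleftrightarrow> (\<forall>i. \<forall>x\<in>I. P i x = Q i x)"

definition pdo_fun :: "(real \<Rightarrow> complex) \<Rightarrow> pdo" where
  "pdo_fun r = (\<lambda>i x. if i = 0 then r x else 0)"

definition pdo_pow_dx :: "int \<Rightarrow> pdo" where
  "pdo_pow_dx k = (\<lambda>i x. if i = k then 1 else 0)"

text \<open>
  By \<open>\<partial>\<^sup>i \<cdot> r = \<Sum>\<^sub>l (i choose l) r\<^bsup>(l)\<^esup> \<partial>\<^bsup>i-l\<^esup>\<close>, the pair \<open>P\<^sub>i \<partial>\<^sup>i\<close>, \<open>Q\<^sub>j \<partial>\<^sup>j\<close> contributes to \<open>\<partial>\<^sup>n\<close> exactly for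
  \<open>j = n - i + l\<close>.
\<close>
definition pdo_mult :: "pdo \<Rightarrow> pdo \<Rightarrow> pdo" where
  "pdo_mult P Q = (\<lambda>n x. Sum_any (\<lambda>(i::int, l::nat).
     (of_int i gchoose l) * P i x * (D1 ^^ l) (Q (n - i + int l)) x))"

fun pdo_power :: "pdo \<Rightarrow> nat \<Rightarrow> pdo" where
  "pdo_power P 0 = pdo_pow_dx 0"
| "pdo_power P (Suc k) = pdo_mult P (pdo_power P k)"

text \<open>\<open>(\<Sum>\<^sub>i r\<^sub>i \<partial>\<^sup>i)\<^sup>* = \<Sum>\<^sub>i (-\<partial>)\<^sup>i \<cdot> r\<^sub>i\<close>\<close>
definition pdo_adjoint :: "pdo \<Rightarrow> pdo" where
  "pdo_adjoint P = (\<lambda>n x. Sum_any (\<lambda>i::int.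
     (-1) powi i * pdo_mult (pdo_pow_dx i) (pdo_fun (P i)) n x))"

definition pdo_inverse_on :: "real set \<Rightarrow> pdo \<Rightarrow> pdo \<Rightarrow> bool" where
  "pdo_inverse_on I P Q \<longleftrightarrow> pdo_on I Q \<and>
     pdo_eq_on I (pdo_mult P Q) (pdo_pow_dx 0) \<and> pdo_eq_on I (pdo_mult Q P) (pdo_pow_dx 0)"

text \<open>\<open>P e\<^bsup>\<sigma>xz\<^esup> = (\<Sum>\<^sub>i exp_symbol \<sigma> P i x z\<^sup>i) e\<^bsup>\<sigma>xz\<^esup>\<close> for \<open>\<sigma> = \<plusminus>1\<close>\<close>
definition exp_symbol :: "complex \<Rightarrow> pdo \<Rightarrow> int \<Rightarrow> real \<Rightarrow> complex" where
  "exp_symbol \<sigma> P i x = \<sigma> powi i * P i x"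


section \<open>The differential operator, wave operator and wave functions\<close>

definition L_op :: "nat \<Rightarrow> (nat \<Rightarrow> real \<Rightarrow> complex) \<Rightarrow> pdo" where
  "L_op N u = (\<lambda>i x. if i = int N then 1
                     else if 0 \<le> i \<and> i \<le> int N - 2 then u (nat i) x else 0)"

definition wave_operator_on :: "real set \<Rightarrow> nat \<Rightarrow> (nat \<Rightarrow> real \<Rightarrow> complex) \<Rightarrow> pdo \<Rightarrow> bool" where
  "wave_operator_on I N u S \<longleftrightarrow> pdo_on I S \<and>
     (\<forall>x\<in>I. S 0 x = 1) \<and> (\<forall>i>0. \<forall>x\<in>I. S i x = 0) \<and>
     (\<exists>Sinv. pdo_inverse_on I S Sinv \<and>
        pdo_eq_on I (L_op N u) (pdo_mult (pdo_mult S (pdo_pow_dx (int N))) Sinv))"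

text \<open>
  Coefficient of \<open>z\<^bsup>-n\<^esup>\<close> in \<open>\<Psi>(x,z) \<Psi>\<^sup>*(y,z) e\<^bsup>-(x-y)z\<^esup>\<close>, where \<open>\<Psi> = S e\<^bsup>xz\<^esup>\<close> and \<open>\<Psi>\<^sup>* = T e\<^bsup>-xz\<^esup>\<close>, with
  \<open>T\<close> the inverse of the adjoint of \<open>S\<close>.
\<close>
definition omega :: "pdo \<Rightarrow> pdo \<Rightarrow> nat \<Rightarrow> real \<Rightarrow> real \<Rightarrow> complex" where
  "omega S T n x y =
     (\<Sum>k\<le>n. exp_symbol 1 S (- int k) x * exp_symbol (-1) T (- int (n - k)) y)"


section \<open>Heat kernel expansions\<close>

text \<open>
  Write \<open>a\<^sub>j = t\<^bsup>-(j+1)/N\<^esup> A\<^sub>N\<^bsup>(j)\<^esup>((x - y) / t\<^bsup>1/N\<^esup>)\<close>. A formal expansion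
  \<open>\<Sum>\<^sub>j\<^sub>,\<^sub>k F\<^sub>j\<^sub>,\<^sub>k(x,y) a\<^sub>j t\<^sup>k\<close> (\<open>j\<close> a natural number, \<open>k\<close> an integer) is represented by \<open>F\<close>. The chain rule
  gives \<open>\<partial>\<^sub>x a\<^sub>j = a\<^bsub>j+1\<^esub>\<close> and \<open>\<partial>\<^sub>t a\<^sub>j = -(j+1)/N t\<^bsup>-1\<^esup> a\<^sub>j - (x-y)/N t\<^bsup>-1\<^esup> a\<^bsub>j+1\<^esub>\<close>.
\<close>

type_synonym expansion = "nat \<Rightarrow> int \<Rightarrow> real \<Rightarrow> real \<Rightarrow> complex"

definition hk_dx :: "expansion \<Rightarrow> expansion" where
  "hk_dx F = (\<lambda>j k x y.
     D1 (\<lambda>s. F j k s y) x + (if j = 0 then 0 else F (j - 1) k x y))"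

definition hk_dt :: "nat \<Rightarrow> expansion \<Rightarrow> expansion" where
  "hk_dt N F = (\<lambda>j k x y.
     (of_int (k + 1) - of_nat (j + 1) / of_nat N) * F j (k + 1) x y
     - (if j = 0 then 0 else of_real (x - y) / of_nat N * F (j - 1) (k + 1) x y))"

definition hk_L :: "nat \<Rightarrow> (nat \<Rightarrow> real \<Rightarrow> complex) \<Rightarrow> expansion \<Rightarrow> expansion" where
  "hk_L N u F = (\<lambda>j k x y.
     (hk_dx ^^ N) F j k x y + (\<Sum>i\<le>N - 2. u i x * (hk_dx ^^ i) F j k x y))"

text \<open>
  Differentiating the Airy equation \<open>A\<^bsup>(N-1)\<^esup>(z) = -(\<kappa>/N) z A(z)\<close> \<open>m\<close> times gives
  \<open>a\<^bsub>N-1+m\<^esub> = -(\<kappa>/N) t\<^bsup>-1\<^esup> ((x-y) a\<^sub>m + m a\<^bsub>m-1\<^esub>)\<close>. Repeated use of it turns \<open>a\<^sub>i\<close> into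
  \<open>\<Sum>\<^sub>p\<^sub>,\<^sub>j airy_coeff N \<kappa> (x-y) p i j t\<^bsup>-p\<^esup> a\<^sub>j\<close> with \<open>j \<le> N - 2\<close>; below \<open>m = i + 1 - N\<close>.
\<close>
fun airy_coeff :: "nat \<Rightarrow> complex \<Rightarrow> complex \<Rightarrow> nat \<Rightarrow> nat \<Rightarrow> nat \<Rightarrow> complex" where
  "airy_coeff N \<kappa> d 0 i j = (if i + 1 < N \<and> i = j then 1 else 0)"
| "airy_coeff N \<kappa> d (Suc p) i j =
     (if i + 1 < N then 0
      else - (\<kappa> / of_nat N) * (d * airy_coeff N \<kappa> d p (i + 1 - N) j
             + of_nat (i + 1 - N) * airy_coeff N \<kappa> d p (i - N) j))"

text \<open>
  The rules behind \<open>hk_dx\<close>, \<open>hk_dt\<close> and \<open>airy_coeff\<close> hold for the derivatives \<open>A j\<close> of any solution \<open>A 0\<close>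
  of the Airy equation, in particular for \<open>A\<^sub>N\<close>.
\<close>

locale airy_system =
  fixes N :: nat and \<kappa> :: complex and A :: "nat \<Rightarrow> real \<Rightarrow> complex"
  assumes N: "N \<ge> 2"
    and A_deriv: "\<And>j z. (A j has_vector_derivative A (Suc j) z) (at z)"
    and A_airy: "\<And>z. A (N - 1) z = - (\<kappa> / of_nat N) * of_real z * A 0 z"
begin

definition airy_term :: "nat \<Rightarrow> real \<Rightarrow> real \<Rightarrow> real \<Rightarrow> complex" where
  "airy_term j x y t = of_real (t powr (- (real j + 1) / real N)) * A j ((x - y) * t powr (- 1 / real N))"

lemma airy_term_dx:
  assumes "t > 0"
  shows "((\<lambda>x. airy_term j x y t) has_vector_derivative airy_term (Suc j) x y t) (at x)"
proof -
  have "((\<lambda>x. (x - y) * t powr (- 1 / real N)) has_vector_derivative t powr (- 1 / real N)) (at x)"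
    by (auto intro!: derivative_eq_intros)
  from vector_diff_chain_at[OF this A_deriv]
  have "((\<lambda>x. A j ((x - y) * t powr (- 1 / real N))) has_vector_derivative
     t powr (- 1 / real N) *\<^sub>R A (Suc j) ((x - y) * t powr (- 1 / real N))) (at x)"
    by (simp add: o_def)
  from has_vector_derivative_mult_right[OF this, of "of_real (t powr (- (real j + 1) / real N))"]
  moreover have "t powr (- (real (Suc j) + 1) / real N) = t powr (- (real j + 1) / real N) * t powr (- 1 / real N)"
    by (simp only: powr_add[symmetric] add_divide_distrib[symmetric]) simp
  ultimately show ?thesis
    by (simp add: airy_term_def scaleR_conv_of_real mult_ac)
qed

lemma airy_term_dt:
  assumes "t > 0"
  shows "((\<lambda>t. airy_term j x y t) has_vector_derivative
     (- of_nat (j + 1) / of_nat N * airy_term j x y t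
      - of_real (x - y) / of_nat N * airy_term (Suc j) x y t) / of_real t) (at t)"
proof -
  let ?e = "- (real j + 1) / real N" and ?f = "- 1 / real N"
  have p: "((\<lambda>t. t powr e) has_vector_derivative e * t powr e / t) (at t)" for e :: real
    using assms unfolding has_real_derivative_iff_has_vector_derivative[symmetric]
    by (auto intro!: derivative_eq_intros simp: powr_diff)
  have "((\<lambda>t. (x - y) * t powr ?f) has_vector_derivative (x - y) * (?f * t powr ?f / t)) (at t)"
    using has_vector_derivative_mult_right[OF p] .
  from vector_diff_chain_at[OF this A_deriv]
  have 1: "((\<lambda>t. A j ((x - y) * t powr ?f)) has_vector_derivative
     ((x - y) * (?f * t powr ?f / t)) *\<^sub>R A (Suc j) ((x - y) * t powr ?f)) (at t)"
    by (simp only: o_def)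
  have 2: "((\<lambda>t. complex_of_real (t powr ?e)) has_vector_derivative
      complex_of_real (?e * t powr ?e / t)) (at t)"
    using assms
    by (intro has_vector_derivative_of_real p[of ?e, folded has_real_derivative_iff_has_vector_derivative])
  have e: "t powr (- (real (Suc j) + 1) / real N) = t powr ?e * t powr ?f"
    by (simp only: powr_add[symmetric] add_divide_distrib[symmetric]) simp
  show ?thesis
    unfolding airy_term_def e
    by (rule has_vector_derivative_eq_rhs[OF has_vector_derivative_mult[OF 2 1]])
       (use assms N in \<open>simp add: scaleR_conv_of_real field_simps\<close>)
qed

lemma A_reduce:
  "A (N - 1 + m) z = - (\<kappa> / of_nat N) * (of_real z * A m z + of_nat m * A (m - 1) z)"
proof (induction m arbitrary: z)
  case 0
  then show ?case by (simp add: A_airy[simplified])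
next
  case (Suc m)
  let ?g = "\<lambda>z. - (\<kappa> / of_nat N) * (of_real z * A m z + of_nat m * A (m - 1) z)"
  have "((\<lambda>z. of_nat m * A (m - 1) z) has_vector_derivative of_nat m * A m z) (at z)"
    using has_vector_derivative_mult_right[OF A_deriv[of "m - 1" z], of "of_nat m"]
    by (cases m) auto
  moreover have "((\<lambda>z. complex_of_real z) has_vector_derivative 1) (at z)"
    using has_vector_derivative_of_real[OF DERIV_ident[of "at z"]] by simp
  note has_vector_derivative_mult[OF this A_deriv[of m z]]
  ultimately have "(?g has_vector_derivative
     - (\<kappa> / of_nat N) * ((of_real z * A (Suc m) z + 1 * A m z) + of_nat m * A m z)) (at z)"
    by - (rule has_vector_derivative_mult_right, rule has_vector_derivative_add)
  moreover have "(?g has_vector_derivative A (Suc (N - 1 + m)) z) (at z)"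
    using A_deriv[of "N - 1 + m" z] unfolding Suc.IH[abs_def] by simp
  ultimately have "A (Suc (N - 1 + m)) z =
      - (\<kappa> / of_nat N) * ((of_real z * A (Suc m) z + 1 * A m z) + of_nat m * A m z)"
    by (blast intro: vector_derivative_unique_at)
  then show ?case by (simp add: algebra_simps)
qed

lemma airy_term_reduce:
  assumes "t > 0"
  shows "airy_term (N - 1 + m) x y t =
    - (\<kappa> / of_nat N) * (of_real (x - y) * airy_term m x y t + of_nat m * airy_term (m - 1) x y t) / of_real t"
proof -
  have e: "t powr (- (real (N - 1 + m) + 1) / real N) = t powr (- (real m) / real N) / t"
  proof -
    have "- (real (N - 1 + m) + 1) / real N = - (real m) / real N - 1"
      using N by (simp add: of_nat_diff field_simps)
    then show ?thesis using assms by (simp only: powr_diff) simp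
  qed
  have f: "t powr (- (real m + 1) / real N) = t powr (- (real m) / real N) * t powr (- 1 / real N)"
    by (simp add: powr_add[symmetric] add_divide_distrib[symmetric])
       (simp add: add_ac diff_divide_distrib)
  show ?thesis
    unfolding airy_term_def A_reduce e f
    using assms N
    apply (cases m)
    apply (simp_all add: field_simps)
    done
qed

lemma airy_coeff_sound:
  assumes "t > 0"
  shows "airy_term i x y t =
    (\<Sum>p\<le>i. \<Sum>j\<le>N - 2. airy_coeff N \<kappa> (of_real (x - y)) p i j * airy_term j x y t / of_real t ^ p)"
proof -
  let ?c = "airy_coeff N \<kappa> (of_real (x - y))"
  have van: "i < p \<Longrightarrow> ?c p i j = 0" for i p j
    using N by (induction p arbitrary: i) auto
  define R where "R p i = (\<Sum>j\<le>N - 2. ?c p i j * airy_term j x y t)" for p i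
  have "n \<ge> i \<Longrightarrow> airy_term i x y t = (\<Sum>p\<le>n. R p i / of_real t ^ p)" for n
  proof (induction n arbitrary: i)
    case 0
    then show ?case using N by (simp add: R_def if_distrib[of "\<lambda>c. c * _"] cong: if_cong)
  next
    case (Suc n)
    show ?case
    proof (cases "i + 1 < N")
      case True
      have "R (Suc p) i = 0" for p using True by (simp add: R_def)
      moreover have "R 0 i = (\<Sum>j\<le>N-2. if i = j then airy_term j x y t else 0)"
        using True unfolding R_def by (intro sum.cong) auto
      then have "R 0 i = airy_term i x y t" using True by simp
      ultimately show ?thesis by (simp add: sum.atMost_Suc_shift del: sum.atMost_Suc)
    next
      case False
      let ?m = "i + 1 - N"
      have m: "i = N - 1 + ?m" "i - N = ?m - 1" using False N by auto
      have R0: "R 0 i = 0" using False by (simp add: R_def)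
      have distr: "k * (d * c + m * c') * b = k * (d * (c * b) + m * (c' * b))"
        for k d c m c' b :: complex
        by (simp add: algebra_simps)
      have RS: "R (Suc p) i = - (\<kappa> / of_nat N) * (of_real (x - y) * R p ?m + of_nat ?m * R p (i - N))" for p
        using False unfolding R_def sum_distrib_left sum.distrib[symmetric]
        by (intro sum.cong refl) (simp only: airy_coeff.simps if_False distr)
      have "airy_term i x y t = - (\<kappa> / of_nat N) * (of_real (x - y) * airy_term ?m x y t + of_nat ?m * airy_term (i - N) x y t) / of_real t"
        by (rule airy_term_reduce[OF assms, of ?m x y, folded m])
      also have "airy_term ?m x y t = (\<Sum>p\<le>n. R p ?m / of_real t ^ p)"
        using Suc.prems N by (intro Suc.IH) auto
      also have "airy_term (i - N) x y t = (\<Sum>p\<le>n. R p (i - N) / of_real t ^ p)"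
        using Suc.prems N by (intro Suc.IH) auto
      also have "- (\<kappa> / of_nat N) * (of_real (x - y) * (\<Sum>p\<le>n. R p ?m / of_real t ^ p) +
          of_nat ?m * (\<Sum>p\<le>n. R p (i - N) / of_real t ^ p)) / of_real t
          = (\<Sum>p\<le>n. R (Suc p) i / of_real t ^ Suc p)"
      proof -
        have "k * (d * (X / T) + m * (Y / T)) / s = k * (d * X + m * Y) / (s * T)"
          for k d X T m Y s :: complex
          by (simp add: divide_inverse inverse_mult_distrib distrib_left distrib_right mult_ac)
        then show ?thesis
          unfolding RS sum_distrib_left sum.distrib[symmetric] sum_divide_distrib power_Suc
          by (intro sum.cong refl)
      qed
      finally show ?thesis by (simp add: R0 sum.atMost_Suc_shift del: sum.atMost_Suc)
    qed
  qed
  from this[of i] show ?thesis by (simp add: R_def sum_divide_distrib)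
qed

end

definition hk_reduce :: "nat \<Rightarrow> complex \<Rightarrow> expansion \<Rightarrow> expansion" where
  "hk_reduce N \<kappa> F = (\<lambda>j k x y. Sum_any (\<lambda>(i::nat, p::nat).
     F i (k + int p) x y * airy_coeff N \<kappa> (of_real (x - y)) p i j))"

definition heat_kernel :: "nat \<Rightarrow> (nat \<Rightarrow> nat \<Rightarrow> real \<Rightarrow> real \<Rightarrow> complex) \<Rightarrow> expansion" where
  "heat_kernel N H = (\<lambda>j k x y.
     if j = 0 \<and> k = 0 then 1
     else if j \<le> N - 2 \<and> 1 \<le> k then H j (nat k) x y else 0)"

text \<open>\<open>H j k\<close> stands for \<open>H\<^sub>k\<^sup>j\<close> with \<open>j \<le> N - 2\<close> and \<open>k \<ge> 1\<close>.\<close>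
definition hadamard_coeffs_on ::
  "(real \<times> real) set \<Rightarrow> nat \<Rightarrow> complex \<Rightarrow> (nat \<Rightarrow> real \<Rightarrow> complex)
    \<Rightarrow> (nat \<Rightarrow> nat \<Rightarrow> real \<Rightarrow> real \<Rightarrow> complex) \<Rightarrow> bool" where
  "hadamard_coeffs_on U N \<kappa> u H \<longleftrightarrow>
     (\<forall>j\<le>N - 2. \<forall>k::int. \<forall>(x, y)\<in>U.
        hk_reduce N \<kappa> (hk_dt N (heat_kernel N H)) j k x y
        = \<kappa> * hk_reduce N \<kappa> (hk_L N u (heat_kernel N H)) j k x y) \<and>
     (\<forall>j\<le>N - 2. \<forall>k\<ge>1. smooth_on U (\<lambda>(x, y). H j k x y))"

text \<open>
  An open neighbourhood of the diagonal of \<open>I \<times> I\<close>. The slices in \<open>x\<close> are intervals (which contain \<open>y\<close>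
  when nonempty): on a slice with a component away from the diagonal the equations would not
  determine the coefficients.
\<close>
definition diagonal_nhd :: "real set \<Rightarrow> (real \<times> real) set \<Rightarrow> bool" where
  "diagonal_nhd I U \<longleftrightarrow> open U \<and> U \<subseteq> I \<times> I \<and> (\<forall>x\<in>I. (x, x) \<in> U) \<and>
     (\<forall>y. is_interval {x. (x, y) \<in> U})"


section \<open>The operator built from Hadamard's coefficients\<close>

text \<open>
  Throughout, \<open>y\<close> is a parameter: an operator depending on \<open>y\<close> is a \<open>pdo\<close> in \<open>x\<close> for each fixed \<open>y\<close>, so
  \<open>y\<close> is inert under \<open>\<partial>\<^sub>x\<close> even if it is equated with \<open>x\<close> in the coefficients afterwards.
\<close>

definition D_op :: "nat \<Rightarrow> real \<Rightarrow> pdo" where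
  "D_op N y = (\<lambda>i x. - pdo_mult (pdo_pow_dx (1 - int N)) (pdo_fun (\<lambda>x. of_real (x - y))) i x)"

lemma D_op_eq:
  "D_op N y = (\<lambda>i x. if i = 1 - int N then - of_real (x - y)
     else if i = - int N then of_nat N - 1 else 0)"
proof (intro ext)
  fix i :: int and x :: real
  have d1: "D1 (\<lambda>x. of_real (x - y)) = (\<lambda>x. 1)"
  proof
    fix x
    have "((\<lambda>x. complex_of_real (x - y)) has_vector_derivative of_real 1) (at x)"
      by (intro has_vector_derivative_of_real) (auto intro!: derivative_eq_intros)
    then show "D1 (\<lambda>x. of_real (x - y)) x = 1" by (simp add: D1_def vector_derivative_at)
  qed
  note d1' = d1[simplified]
  have c: "D1 (\<lambda>x. c) = (\<lambda>x. 0)" for c by (simp add: D1_def fun_eq_iff)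
  have z: "(D1 ^^ l) (\<lambda>x. 0) = (\<lambda>x. 0)" for l by (induction l) (auto simp: c)
  have dl: "(D1 ^^ l) (\<lambda>x. of_real (x - y)) x = (if l = 0 then of_real (x - y) else if l = 1 then 1 else 0)"
    for l
  proof (cases l)
    case (Suc l')
    then show ?thesis
      by (cases l') (simp_all add: funpow_Suc_right d1' c z del: funpow.simps)
  qed simp
  have dl': "(D1 ^^ l) (pdo_fun (\<lambda>x. of_real (x - y)) n) x = 0" if "l > 1" for l n
    using that dl[of l] z[of l] by (cases "n = 0") (simp_all add: pdo_fun_def)
  let ?g = "\<lambda>(k::int, l::nat). (of_int k gchoose l) * pdo_pow_dx (1 - int N) k x *
      (D1 ^^ l) (pdo_fun (\<lambda>x. of_real (x - y)) (i - k + int l)) x"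
  have g0: "?g (k, l) = 0" if "(k, l) \<notin> {(1 - int N, 0), (1 - int N, 1)}" for k l
    using that dl'[of l] by (cases "k = 1 - int N") (auto simp: pdo_pow_dx_def)
  have "{q. ?g q \<noteq> 0} \<subseteq> {(1 - int N, 0), (1 - int N, 1)}"
  proof
    fix q assume q: "q \<in> {q. ?g q \<noteq> 0}"
    show "q \<in> {(1 - int N, 0), (1 - int N, 1)}"
      by (rule ccontr) (use q g0[of "fst q" "snd q"] in \<open>simp add: case_prod_unfold\<close>)
  qed
  then have "Sum_any ?g = sum ?g {(1 - int N, 0), (1 - int N, 1)}"
    by (intro Sum_any.expand_superset) simp_all
  then show "D_op N y i x = (if i = 1 - int N then - of_real (x - y)
     else if i = - int N then of_nat N - 1 else 0)"
    by (auto simp: D_op_def pdo_mult_def pdo_pow_dx_def pdo_fun_def d1' c)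
qed

text \<open>
  Since \<open>\<partial>\<^sup>j D\<^sub>N\<^sup>k\<close> has order at most \<open>j - k (N - 1)\<close>, only finitely many \<open>k\<close> contribute to a given power
  of \<open>\<partial>\<^sub>x\<close>.
\<close>
definition H_op :: "nat \<Rightarrow> complex \<Rightarrow> (nat \<Rightarrow> nat \<Rightarrow> real \<Rightarrow> real \<Rightarrow> complex) \<Rightarrow> real \<Rightarrow> pdo" where
  "H_op N \<kappa> H y = (\<lambda>i x. pdo_pow_dx 0 i x +
     (\<Sum>j\<le>N - 2. Sum_any (\<lambda>k::nat. if k = 0 then 0 else
        H j k x y * (\<kappa> ^ k / of_nat N ^ k) *
        pdo_mult (pdo_pow_dx (int j)) (pdo_power (D_op N y) k) i x)))"

text \<open>\<open>\<Sum>\<^bsub>n\<ge>0\<^esub> w\<^sub>n \<partial>\<^bsup>-n\<^esup>\<close>\<close>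
definition pdo_series :: "(nat \<Rightarrow> real \<Rightarrow> complex) \<Rightarrow> pdo" where
  "pdo_series w = (\<lambda>i x. if i \<le> 0 then w (nat (- i)) x else 0)"

end

theory Submission
  imports Defs
begin

text \<open>
  Fix \<open>y\<close>. The assignment \<open>t\<^sup>k a\<^sub>j \<mapsto> (\<kappa>/N)\<^sup>k \<partial>\<^sup>j D\<^sub>N\<^sup>k\<close> respects the Airy relation and turns multiplication by \<open>t\<close>
  into right multiplication by \<open>(\<kappa>/N) D\<^sub>N\<close>, so it maps the heat equation for the expansion to
  \<open>(L G - G \<partial>\<^sup>N) D\<^sub>N\<^sup>K = 0\<close> for \<open>G = H(x,y,\<partial>\<^sub>x)\<close>; the power \<open>D\<^sub>N\<^sup>K\<close> absorbs the negative powers of \<open>t\<close>. Right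
  multiplication by \<open>D\<^sub>N\<close> acts pointwise in \<open>x\<close> and is injective for \<open>x \<noteq> y\<close>, so \<open>L G = G \<partial>\<^sup>N\<close> off the
  diagonal, and on it by continuity. The operator \<open>W = \<Sum> \<omega>\<^sub>n \<partial>\<^bsup>-n\<^esup>\<close> also satisfies \<open>L W = W \<partial>\<^sup>N\<close>, which
  determines its coefficients up to one constant of integration each. These constants are
  fixed by the residues of \<open>\<partial>\<^sup>i G\<close> and \<open>\<partial>\<^sup>i W\<close> at \<open>x = y\<close>, which all vanish: for \<open>G\<close> because every
  operator \<open>P D\<^sub>N\<close> has zero residue there, for \<open>W\<close> because they are coefficients of \<open>T S\<^sup>* = 1\<close>.
\<close>

section \<open>Infinitely differentiable functions of one variable\<close>

text \<open>A one-variable counterpart of \<open>times_diff_on\<close> built on \<open>D1\<close>,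
  so that higher derivatives appear as \<open>D1 ^^ n\<close>. Order 0 asks nothing, since
  continuity already follows from order 1.\<close>

fun diffs_on :: "nat \<Rightarrow> real set \<Rightarrow> (real \<Rightarrow> complex) \<Rightarrow> bool" where
  "diffs_on 0 J f \<longleftrightarrow> True"
| "diffs_on (Suc n) J f \<longleftrightarrow> (\<forall>x\<in>J. f differentiable (at x)) \<and> diffs_on n J (D1 f)"

definition inf_diff_on :: "real set \<Rightarrow> (real \<Rightarrow> complex) \<Rightarrow> bool" where
  "inf_diff_on J f \<longleftrightarrow> (\<forall>n. diffs_on n J f)"

lemma D1_eqI: "(f has_vector_derivative f') (at x) \<Longrightarrow> D1 f x = f'"
  by (simp add: D1_def vector_derivative_at)

lemma has_vector_derivative_D1:
  "f differentiable (at x) \<Longrightarrow> (f has_vector_derivative D1 f x) (at x)"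
  by (simp add: D1_def vector_derivative_works)

lemma differentiable_cong_open:
  fixes f :: "real \<Rightarrow> complex"
  assumes "open J" "\<And>x. x \<in> J \<Longrightarrow> f x = g x" "x \<in> J"
  shows "f differentiable (at x) \<longleftrightarrow> g differentiable (at x)" and "D1 f x = D1 g x"
proof -
  have *: "(f has_vector_derivative D) (at x) \<longleftrightarrow> (g has_vector_derivative D) (at x)" for D
    using has_vector_derivative_transform_within_open[OF _ assms(1,3)] assms(2)
    by metis
  show "D1 f x = D1 g x" unfolding D1_def vector_derivative_def * ..
  have "f differentiable (at x) \<longleftrightarrow> (\<exists>D. (f has_vector_derivative D) (at x))" for f :: "real \<Rightarrow> complex"
    using has_vector_derivative_D1 differentiableI_vector by blast
  then show "f differentiable (at x) \<longleftrightarrow> g differentiable (at x)" using * by simp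
qed

lemma D1_funpow_cong:
  assumes "open J" "\<And>x. x \<in> J \<Longrightarrow> f x = g x" "x \<in> J"
  shows "(D1 ^^ n) f x = (D1 ^^ n) g x"
  using assms(3)
proof (induction n arbitrary: x)
  case 0 then show ?case using assms by simp
next
  case (Suc n)
  then show ?case using differentiable_cong_open(2)[OF assms(1) Suc.IH] by simp
qed

lemma D1_add:
  assumes "f differentiable (at x)" "g differentiable (at x)"
  shows "D1 (\<lambda>x. f x + g x) x = D1 f x + D1 g x"
  by (intro D1_eqI has_vector_derivative_add has_vector_derivative_D1 assms)

lemma D1_mult:
  assumes "f differentiable (at x)" "g differentiable (at x)"
  shows "D1 (\<lambda>x. f x * g x) x = D1 f x * g x + f x * D1 g x"
  using D1_eqI[OF has_vector_derivative_mult[OF has_vector_derivative_D1[OF assms(1)] has_vector_derivative_D1[OF assms(2)]]]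
  by simp

lemma D1_const [simp]: "D1 (\<lambda>x. c) = (\<lambda>x. 0)"
  by (intro ext D1_eqI) simp

lemma D1_funpow_zero [simp]: "(D1 ^^ n) (\<lambda>x. 0) = (\<lambda>x. 0)"
  by (induction n) auto

lemma D1_funpow_eq_zero:
  assumes "open J" "\<And>x. x \<in> J \<Longrightarrow> f x = 0" "x \<in> J"
  shows "(D1 ^^ n) f x = 0"
  using D1_funpow_cong[OF assms(1), of f "\<lambda>x. 0" x n] assms by simp

lemma diffs_on_cong:
  assumes "open J" "\<And>x. x \<in> J \<Longrightarrow> f x = g x"
  shows "diffs_on n J f \<longleftrightarrow> diffs_on n J g"
  using assms(2)
proof (induction n arbitrary: f g)
  case (Suc n)
  have "D1 f x = D1 g x" "f differentiable (at x) \<longleftrightarrow> g differentiable (at x)" if "x \<in> J" for x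
    using differentiable_cong_open[OF assms(1) Suc.prems that] by auto
  then show ?case using Suc.IH[of "D1 f" "D1 g"] by simp
qed simp

lemma inf_diff_on_cong:
  assumes "open J" "\<And>x. x \<in> J \<Longrightarrow> f x = g x"
  shows "inf_diff_on J f \<longleftrightarrow> inf_diff_on J g"
  using diffs_on_cong[OF assms] by (simp add: inf_diff_on_def)

lemma diffs_on_SucD: "diffs_on (Suc n) J f \<Longrightarrow> diffs_on n J f"
  by (induction n arbitrary: f) auto

lemma diffs_on_add:
  assumes "open J" "diffs_on n J f" "diffs_on n J g"
  shows "diffs_on n J (\<lambda>x. f x + g x)"
  using assms(2,3)
proof (induction n arbitrary: f g)
  case (Suc n)
  then have "diffs_on n J (\<lambda>x. D1 f x + D1 g x)" by simp
  then have "diffs_on n J (D1 (\<lambda>x. f x + g x))"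
    using Suc.prems by (subst diffs_on_cong[OF assms(1)]) (auto simp: D1_add)
  then show ?case using Suc.prems by simp
qed simp

lemma diffs_on_mult:
  assumes "open J" "diffs_on n J f" "diffs_on n J g"
  shows "diffs_on n J (\<lambda>x. f x * g x)"
  using assms(2,3)
proof (induction n arbitrary: f g)
  case (Suc n)
  then have "diffs_on n J (\<lambda>x. D1 f x * g x)" "diffs_on n J (\<lambda>x. f x * D1 g x)"
    using diffs_on_SucD[OF Suc.prems(1)] diffs_on_SucD[OF Suc.prems(2)] by simp_all
  then have "diffs_on n J (\<lambda>x. D1 f x * g x + f x * D1 g x)"
    by (rule diffs_on_add[OF assms(1)])
  then have "diffs_on n J (D1 (\<lambda>x. f x * g x))"
    using Suc.prems
    by (subst diffs_on_cong[OF assms(1), of _ "\<lambda>x. D1 f x * g x + f x * D1 g x"]) (auto simp: D1_mult)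
  then show ?case using Suc.prems by simp
qed simp

lemma diffs_on_const: "diffs_on n J (\<lambda>x. c)"
proof (induction n arbitrary: c)
  case (Suc n)
  then show ?case by simp
qed simp

lemma inf_diff_on_const [intro, simp]: "inf_diff_on J (\<lambda>x. c)"
  by (simp add: inf_diff_on_def diffs_on_const)

lemma inf_diff_on_add:
  "open J \<Longrightarrow> inf_diff_on J f \<Longrightarrow> inf_diff_on J g \<Longrightarrow> inf_diff_on J (\<lambda>x. f x + g x)"
  by (simp add: inf_diff_on_def diffs_on_add)

lemma inf_diff_on_mult:
  "open J \<Longrightarrow> inf_diff_on J f \<Longrightarrow> inf_diff_on J g \<Longrightarrow> inf_diff_on J (\<lambda>x. f x * g x)"
  by (simp add: inf_diff_on_def diffs_on_mult)

lemma inf_diff_on_D1: "inf_diff_on J f \<Longrightarrow> inf_diff_on J (D1 f)"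
  unfolding inf_diff_on_def by (metis diffs_on.simps(2))

lemma inf_diff_on_D1_funpow: "inf_diff_on J f \<Longrightarrow> inf_diff_on J ((D1 ^^ n) f)"
  by (induction n) (auto intro: inf_diff_on_D1)

lemma inf_diff_on_differentiable: "inf_diff_on J f \<Longrightarrow> x \<in> J \<Longrightarrow> f differentiable (at x)"
  unfolding inf_diff_on_def by (metis diffs_on.simps(2))

lemma inf_diff_on_sum:
  "open J \<Longrightarrow> (\<And>i. i \<in> A \<Longrightarrow> inf_diff_on J (f i)) \<Longrightarrow> inf_diff_on J (\<lambda>x. \<Sum>i\<in>A. f i x)"
  by (induction A rule: infinite_finite_induct) (auto intro: inf_diff_on_add)

lemma inf_diff_on_subset:
  assumes "inf_diff_on J f" "J' \<subseteq> J" shows "inf_diff_on J' f"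
proof -
  have "diffs_on n J f \<Longrightarrow> diffs_on n J' f" for n f
    using assms(2) by (induction n arbitrary: f) auto
  then show ?thesis using assms(1) by (simp add: inf_diff_on_def)
qed

lemma inf_diff_on_of_real: "inf_diff_on J (\<lambda>x. complex_of_real (x - y))"
proof -
  have *: "((\<lambda>x. complex_of_real (x - y)) has_vector_derivative of_real 1) (at x)" for x
    by (intro has_vector_derivative_of_real) (auto intro!: derivative_eq_intros)
  then have "D1 (\<lambda>x. complex_of_real (x - y)) = (\<lambda>x. 1)"
    by (intro ext) (auto dest: D1_eqI)
  then have "diffs_on n J (\<lambda>x. complex_of_real (x - y))" for n
    using * by (cases n) (auto simp: diffs_on_const intro: differentiableI_vector simp del: of_real_diff)
  then show ?thesis by (simp add: inf_diff_on_def)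
qed

lemma D1_of_real_diff: "D1 (\<lambda>x. complex_of_real (x - y)) x = 1"
proof -
  have "((\<lambda>x. complex_of_real (x - y)) has_vector_derivative of_real 1) (at x)"
    by (intro has_vector_derivative_of_real) (auto intro!: derivative_eq_intros)
  then show ?thesis by (auto dest: D1_eqI)
qed

lemma D1_funpow_add:
  assumes "open J" "inf_diff_on J f" "inf_diff_on J g" "x \<in> J"
  shows "(D1 ^^ n) (\<lambda>x. f x + g x) x = (D1 ^^ n) f x + (D1 ^^ n) g x"
  using assms(4)
proof (induction n arbitrary: x)
  case (Suc n)
  have "(D1 ^^ Suc n) (\<lambda>x. f x + g x) x = D1 (\<lambda>x. (D1 ^^ n) f x + (D1 ^^ n) g x) x"
    using differentiable_cong_open(2)[OF assms(1) Suc.IH Suc.prems] by simp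
  also have "\<dots> = (D1 ^^ Suc n) f x + (D1 ^^ Suc n) g x"
    using D1_add[OF inf_diff_on_differentiable[OF inf_diff_on_D1_funpow[OF assms(2)] Suc.prems]
       inf_diff_on_differentiable[OF inf_diff_on_D1_funpow[OF assms(3)] Suc.prems]] by simp
  finally show ?case .
qed simp

lemma D1_funpow_sum:
  assumes "open J" "\<And>i. i \<in> A \<Longrightarrow> inf_diff_on J (f i)" "x \<in> J"
  shows "(D1 ^^ n) (\<lambda>x. \<Sum>i\<in>A. f i x) x = (\<Sum>i\<in>A. (D1 ^^ n) (f i) x)"
  using assms(2)
proof (induction A rule: infinite_finite_induct)
  case (insert a A)
  then show ?case
    using D1_funpow_add[OF assms(1), of "f a" "\<lambda>x. \<Sum>i\<in>A. f i x" x n] assms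
    by (simp add: inf_diff_on_sum)
qed auto

lemma D1_sum:
  assumes "open J" "\<And>i. i \<in> A \<Longrightarrow> inf_diff_on J (f i)" "x \<in> J"
  shows "D1 (\<lambda>x. \<Sum>i\<in>A. f i x) x = (\<Sum>i\<in>A. D1 (f i) x)"
  using D1_funpow_sum[where f = f and A = A and J = J and x = x and n = 1] assms by simp

lemma D1_funpow_cmult:
  assumes "open J" "inf_diff_on J f" "x \<in> J"
  shows "(D1 ^^ n) (\<lambda>x. c * f x) x = c * (D1 ^^ n) f x"
  using assms(3)
proof (induction n arbitrary: x)
  case (Suc n)
  have "(D1 ^^ Suc n) (\<lambda>x. c * f x) x = D1 (\<lambda>x. c * (D1 ^^ n) f x) x"
    using differentiable_cong_open(2)[OF assms(1) Suc.IH Suc.prems] by simp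
  also have "\<dots> = c * (D1 ^^ Suc n) f x"
    using D1_mult[of "\<lambda>_. c", OF _ inf_diff_on_differentiable[OF inf_diff_on_D1_funpow[OF assms(2)] Suc.prems]]
    by simp
  finally show ?case .
qed simp

lemma D1_funpow_mult:
  assumes "open J" "inf_diff_on J f" "inf_diff_on J g" "x \<in> J"
  shows "(D1 ^^ n) (\<lambda>x. f x * g x) x
    = (\<Sum>r\<le>n. of_nat (n choose r) * (D1 ^^ r) f x * (D1 ^^ (n - r)) g x)"
  using assms(2-4)
proof (induction n arbitrary: f g x)
  case (Suc n)
  note d = inf_diff_on_D1
  let ?t = "\<lambda>m r. (D1 ^^ r) f x * (D1 ^^ (m - r)) g x"
  have "(D1 ^^ Suc n) (\<lambda>x. f x * g x) x = (D1 ^^ n) (\<lambda>x. D1 f x * g x + f x * D1 g x) x"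
    unfolding funpow_Suc_right o_def
    using Suc.prems inf_diff_on_differentiable
    by (intro D1_funpow_cong[OF assms(1)] D1_mult) auto
  also have "\<dots> = (D1 ^^ n) (\<lambda>x. D1 f x * g x) x + (D1 ^^ n) (\<lambda>x. f x * D1 g x) x"
    using Suc.prems d by (intro D1_funpow_add[OF assms(1)] inf_diff_on_mult[OF assms(1)]) auto
  also have "(D1 ^^ n) (\<lambda>x. D1 f x * g x) x = (\<Sum>r\<le>n. of_nat (n choose r) * ?t (Suc n) (Suc r))"
    using Suc.IH[OF d[OF Suc.prems(1)] Suc.prems(2,3)] by (simp add: funpow_swap1 mult.assoc)
  also have "(D1 ^^ n) (\<lambda>x. f x * D1 g x) x = (\<Sum>r\<le>n. of_nat (n choose r) * ?t (Suc n) r)"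
    using Suc.IH[OF Suc.prems(1) d[OF Suc.prems(2)] Suc.prems(3)]
    by (simp add: funpow_swap1 mult.assoc Suc_diff_le)
  \<comment> \<open>The added term r = Suc n has binomial coefficient 0; with it, splitting off r =
    0 aligns the two sums for Pascal's rule.\<close>
  also have "\<dots> = (\<Sum>r\<le>Suc n. of_nat (n choose r) * ?t (Suc n) r)" by simp
  also have "\<dots> = ?t (Suc n) 0 + (\<Sum>r\<le>n. of_nat (n choose Suc r) * ?t (Suc n) (Suc r))"
    by (subst sum.atMost_Suc_shift) simp
  finally have "(D1 ^^ Suc n) (\<lambda>x. f x * g x) x =
     ?t (Suc n) 0 + (\<Sum>r\<le>n. of_nat (Suc n choose Suc r) * ?t (Suc n) (Suc r))"
    by (simp add: sum.distrib[symmetric] algebra_simps)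
  also have "\<dots> = (\<Sum>r\<le>Suc n. of_nat (Suc n choose r) * ?t (Suc n) r)"
    by (simp only: sum.atMost_Suc_shift binomial_n_0 of_nat_1 mult_1_left)
  finally show ?case by (simp only: mult.assoc)
qed simp

section \<open>Smooth functions of one and of two real variables\<close>

lemma frechet_derivative_eq_D1:
  "f differentiable (at x) \<Longrightarrow> frechet_derivative f (at x) v = of_real v * D1 f x"
  using has_vector_derivative_D1[of f x] frechet_derivative_at[of f "\<lambda>h. h *\<^sub>R D1 f x" x]
  by (metis has_vector_derivative_def scaleR_conv_of_real)

lemma times_diff_on_cong:
  assumes "open U" "\<And>p. p \<in> U \<Longrightarrow> f p = g p"
  shows "times_diff_on n U f \<longleftrightarrow> times_diff_on n U g"
  using assms(2)
proof (induction n arbitrary: f g)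
  case 0
  then show ?case using continuous_on_cong[of U U f g] by simp
next
  case (Suc n)
  have *: "(f has_derivative D) (at p) \<longleftrightarrow> (g has_derivative D) (at p)" if "p \<in> U" for p D
    using has_derivative_transform_within_open[OF _ assms(1) that] Suc.prems by metis
  have "frechet_derivative f (at p) = frechet_derivative g (at p)"
       "f differentiable (at p) \<longleftrightarrow> g differentiable (at p)" if "p \<in> U" for p
    using *[OF that] by (auto simp: frechet_derivative_def differentiable_def)
  then show ?case using Suc.IH[of "\<lambda>p. frechet_derivative f (at p) v" "\<lambda>p. frechet_derivative g (at p) v" for v]
    by simp
qed

text \<open>The directional derivative along 1 is \<open>D1\<close> on \<open>J\<close>, and
  openness of \<open>J\<close> carries this equality through the higher orders.\<close>

lemma smooth_on_imp_inf_diff_on: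
  assumes "open J" "smooth_on J f"
  shows "inf_diff_on J f"
proof -
  have "times_diff_on n J f \<Longrightarrow> diffs_on n J f" for n and f :: "real \<Rightarrow> complex"
  proof (induction n arbitrary: f)
    case (Suc n)
    have "times_diff_on n J (\<lambda>p. frechet_derivative f (at p) 1)" using Suc.prems by simp
    then have "times_diff_on n J (D1 f)"
      using Suc.prems by (subst (asm) times_diff_on_cong[OF assms(1)]) (auto simp: frechet_derivative_eq_D1)
    then show ?case using Suc by simp
  qed simp
  then show ?thesis using assms(2) by (simp add: inf_diff_on_def smooth_on_def)
qed

lemma open_slice:
  fixes U :: "(real \<times> real) set"
  assumes "open U" shows "open {x. (x, y) \<in> U}"
  using open_vimage[OF assms, of "\<lambda>x. (x, y)"] by (simp add: vimage_def continuous_on_Pair)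

text \<open>Derivatives along (1, 0) are derivatives in x for fixed y, so the induction follows this
  direction alone.\<close>

lemma smooth_on_slice:
  fixes U :: "(real \<times> real) set"
  assumes "open U" "smooth_on U (\<lambda>(x, y). f x y)"
  shows "inf_diff_on {x. (x, y) \<in> U} (\<lambda>x. f x y)"
proof -
  let ?J = "{x. (x, y) \<in> U}"
  note o = open_slice[OF assms(1), of y]
  have "times_diff_on n U F \<Longrightarrow> diffs_on n ?J (\<lambda>x. F (x, y))" for n and F :: "(real \<times> real) \<Rightarrow> complex"
  proof (induction n arbitrary: F)
    case (Suc n)
    have d: "((\<lambda>x. F (x, y)) has_vector_derivative frechet_derivative F (at (x, y)) (1, 0)) (at x)"
      if "x \<in> ?J" for x
    proof -
      have "(F has_derivative frechet_derivative F (at (x, y))) (at (x, y))"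
        using Suc.prems that by (simp add: frechet_derivative_works)
      moreover have "((\<lambda>x. (x, y)) has_derivative (\<lambda>h. (h, 0))) (at x)"
        by (auto intro!: derivative_eq_intros)
      ultimately have "((\<lambda>x. F (x, y)) has_derivative (\<lambda>h. frechet_derivative F (at (x, y)) (h, 0))) (at x)"
        by (rule has_derivative_compose[rotated])
      moreover have "(\<lambda>h. frechet_derivative F (at (x, y)) (h, 0)) = (\<lambda>h. h *\<^sub>R frechet_derivative F (at (x, y)) (1, 0))"
      proof
        fix h
        have "F differentiable (at (x, y))" using Suc.prems that by auto
        from linear_cmul[OF linear_frechet_derivative[OF this], of h "(1, 0)"]
        show "frechet_derivative F (at (x, y)) (h, 0) = h *\<^sub>R frechet_derivative F (at (x, y)) (1, 0)"
          by simp
      qed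
      ultimately show ?thesis by (simp only: has_vector_derivative_def)
    qed
    have "diffs_on n ?J (\<lambda>x. frechet_derivative F (at (x, y)) (1, 0))"
      using Suc.IH[of "\<lambda>p. frechet_derivative F (at p) (1, 0)"] Suc.prems by simp
    then have "diffs_on n ?J (D1 (\<lambda>x. F (x, y)))"
      using D1_eqI[OF d] by (subst diffs_on_cong[OF o]) auto
    then show ?case using d by (auto intro: differentiableI_vector)
  qed simp
  from this[of _ "\<lambda>(x, y). f x y"] show ?thesis
    using assms(2) by (simp add: inf_diff_on_def smooth_on_def)
qed

section \<open>Composition of formal pseudo-differential operators\<close>

lemma D1_funpow_funpow: "(D1 ^^ h) ((D1 ^^ l) f) = (D1 ^^ (h + l)) f"
  by (simp add: funpow_add)

text \<open>Index set for a coefficient of a product e orders below the top: p and q say how far the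
  two coefficients lie below their own top order, r counts the derivatives that fall on the second
  factor.\<close>

definition triples :: "nat \<Rightarrow> (nat \<times> nat \<times> nat) set" where
  "triples e = {(p, r, q). p + r + q = e}"

lemma finite_triples [simp]: "finite (triples e)"
  by (rule finite_subset[of _ "{..e} \<times> {..e} \<times> {..e}"]) (auto simp: triples_def)

lemma triples_0: "triples 0 = {(0, 0, 0)}"
  by (auto simp: triples_def)

definition inf_diff_pdo :: "real set \<Rightarrow> pdo \<Rightarrow> bool" where
  "inf_diff_pdo J P \<longleftrightarrow> (\<forall>i. inf_diff_on J (P i))"

definition order_le :: "real set \<Rightarrow> int \<Rightarrow> pdo \<Rightarrow> bool" where
  "order_le J a P \<longleftrightarrow> (\<forall>i>a. \<forall>x\<in>J. P i x = 0)"

lemma order_leD: "order_le J a P \<Longrightarrow> i > a \<Longrightarrow> x \<in> J \<Longrightarrow> P i x = 0"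
  by (simp add: order_le_def)

text \<open>A nonzero term needs an index at most a in P and at most b in Q, which leaves finitely
  many. As a finite sum the coefficient can be differentiated and reindexed.\<close>

lemma pdo_mult_graded:
  assumes "open J" "x \<in> J" "order_le J a P" "order_le J b Q"
  shows "pdo_mult P Q (a + b - int e) x =
    (\<Sum>(p, r, q)\<in>triples e. (of_int (a - int p) gchoose r) * P (a - int p) x * (D1 ^^ r) (Q (b - int q)) x)"
proof -
  let ?f = "\<lambda>(i::int, l::nat). (of_int i gchoose l) * P i x * (D1 ^^ l) (Q (a + b - int e - i + int l)) x"
  \<comment> \<open>The component q is determined by p, r and e, so dropping it loses
    nothing.\<close>
  let ?h = "\<lambda>(p, r, q::nat). (a - int p, r::nat)"
  have sup: "{il. ?f il \<noteq> 0} \<subseteq> ?h ` triples e"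
  proof
    fix il assume "il \<in> {il. ?f il \<noteq> 0}"
    then obtain i l where il: "il = (i, l)" "?f (i, l) \<noteq> 0" by (cases il) auto
    have 1: "i \<le> a" using il(2) order_leD[OF assms(3) _ assms(2), of i] by (cases "i \<le> a") auto
    have 2: "a + b - int e - i + int l \<le> b"
    proof (rule ccontr)
      assume "\<not> ?thesis"
      then have "(D1 ^^ l) (Q (a + b - int e - i + int l)) x = 0"
        by (intro D1_funpow_eq_zero[OF assms(1) order_leD[OF assms(4)] assms(2)]) simp
      then show False using il(2) by simp
    qed
    have "(i, l) = ?h (nat (a - i), l, nat (b - (a + b - int e - i + int l)))"
      using 1 by simp
    moreover have "(nat (a - i), l, nat (b - (a + b - int e - i + int l))) \<in> triples e"
      using 1 2 by (simp add: triples_def)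
    ultimately show "il \<in> ?h ` triples e" unfolding il(1) by (rule image_eqI)
  qed
  have inj: "inj_on ?h (triples e)"
    by (auto simp: inj_on_def triples_def)
  have "pdo_mult P Q (a + b - int e) x = sum ?f (?h ` triples e)"
    unfolding pdo_mult_def using sup by (intro Sum_any.expand_superset) auto
  also have "\<dots> = (\<Sum>(p, r, q)\<in>triples e. (of_int (a - int p) gchoose r) * P (a - int p) x * (D1 ^^ r) (Q (b - int q)) x)"
    unfolding sum.reindex[OF inj]
  proof (rule sum.cong[OF refl])
    fix z assume "z \<in> triples e"
    then obtain p r q where z: "z = (p, r, q)" "a + b - int e - (a - int p) + int r = b - int q"
      by (auto simp: triples_def)
    show "(?f \<circ> ?h) z = (case z of (p, r, q) \<Rightarrow>
        (of_int (a - int p) gchoose r) * P (a - int p) x * (D1 ^^ r) (Q (b - int q)) x)"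
      unfolding z(1) o_def prod.case z(2) ..
  qed
  finally show ?thesis .
qed

lemma order_le_mult:
  assumes "open J" "order_le J a P" "order_le J b Q"
  shows "order_le J (a + b) (pdo_mult P Q)"
  unfolding order_le_def
proof (intro allI impI ballI)
  fix n x assume n: "n > a + b" and x: "x \<in> J"
  have "(of_int i gchoose l) * P i x * (D1 ^^ l) (Q (n - i + int l)) x = 0" for i l
  proof (cases "i > a")
    case False
    then have "(D1 ^^ l) (Q (n - i + int l)) x = 0"
      using n by (intro D1_funpow_eq_zero[OF assms(1) order_leD[OF assms(3)] x]) simp
    then show ?thesis by simp
  qed (simp add: order_leD[OF assms(2) _ x])
  then show "pdo_mult P Q n x = 0" unfolding pdo_mult_def by (simp only: case_prod_unfold) simp
qed

lemma inf_diff_pdo_mult: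
  assumes "open J" "order_le J a P" "order_le J b Q" "inf_diff_pdo J P" "inf_diff_pdo J Q"
  shows "inf_diff_pdo J (pdo_mult P Q)"
  unfolding inf_diff_pdo_def
proof
  fix n
  show "inf_diff_on J (pdo_mult P Q n)"
  proof (cases "n > a + b")
    case True
    then show ?thesis
      using order_le_mult[OF assms(1-3)]
      by (subst inf_diff_on_cong[OF assms(1), of _ "\<lambda>x. 0"]) (auto simp: order_le_def)
  next
    case False
    define e where "e = nat (a + b - n)"
    have n: "n = a + b - int e" using False by (simp add: e_def)
    show ?thesis
      unfolding n
      by (subst inf_diff_on_cong[OF assms(1) pdo_mult_graded[OF assms(1) _ assms(2,3)]])
        (use assms in \<open>auto simp: inf_diff_pdo_def case_prod_unfold
          intro!: inf_diff_on_sum inf_diff_on_mult inf_diff_on_D1_funpow\<close>)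
  qed
qed

text \<open>The left factor enters through its values at x only, whereas the right factor is
  differentiated and has to agree on a neighbourhood.\<close>

lemma pdo_mult_cong:
  assumes "open J" "x \<in> J" "\<And>i. P i x = P' i x" "\<And>i z. z \<in> J \<Longrightarrow> Q i z = Q' i z"
  shows "pdo_mult P Q n x = pdo_mult P' Q' n x"
  using assms(3) D1_funpow_cong[OF assms(1) assms(4) assms(2)] by (simp add: pdo_mult_def)

text \<open>Trinomial revision pulls \<open>A gchoose r\<close> out of each term, and the
  Vandermonde convolution sums the rest. This is the numerical identity behind
  associativity.\<close>

lemma gbinomial_convolution:
  "(\<Sum>(l, h)\<in>{(l, h). l + h = m}. ((A::complex) gchoose (r + h)) * of_nat ((r + h) choose r) * (B gchoose l))
    = (A gchoose r) * ((A + B - of_nat r) gchoose m)"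
proof -
  have "(\<Sum>(l, h)\<in>{(l, h). l + h = m}. (A gchoose (r + h)) * of_nat ((r + h) choose r) * (B gchoose l))
     = (\<Sum>l\<le>m. (A gchoose (r + (m - l))) * of_nat ((r + (m - l)) choose r) * (B gchoose l))"
    by (rule sum.reindex_bij_witness[of _ "\<lambda>l. (l, m - l)" fst]) auto
  also have "\<dots> = (\<Sum>l\<le>m. (A gchoose r) * ((B gchoose l) * ((A - of_nat r) gchoose (m - l))))"
  proof (rule sum.cong[OF refl])
    fix l
    show "(A gchoose (r + (m - l))) * of_nat ((r + (m - l)) choose r) * (B gchoose l)
      = (A gchoose r) * ((B gchoose l) * ((A - of_nat r) gchoose (m - l)))"
      using gbinomial_trinomial_revision[of r "r + (m - l)" A] by (simp add: binomial_gbinomial)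
  qed
  also have "\<dots> = (A gchoose r) * ((B + (A - of_nat r)) gchoose m)"
    by (simp add: sum_distrib_left[symmetric] gbinomial_Vandermonde[unfolded atLeast0AtMost])
  finally show ?thesis by (simp add: algebra_simps)
qed

text \<open>Both sides expand into the products \<open>G p r q h l s\<close>: of the derivatives
  produced by P, r hit Q and h hit R, while Q sends l derivatives to R. On the left R receives m = l
  + h derivatives at once; on the right the Leibniz rule splits the k = r + h derivatives of P.
  \<open>gbinomial_convolution\<close> matches the coefficients.\<close>

lemma pdo_mult_assoc:
  assumes J: "open J" "x \<in> J"
    and P: "order_le J a P" and Q: "order_le J b Q" "inf_diff_pdo J Q"
    and R: "order_le J c R" "inf_diff_pdo J R"
  shows "pdo_mult (pdo_mult P Q) R n x = pdo_mult P (pdo_mult Q R) n x"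
proof (cases "n > a + b + c")
  case True
  then show ?thesis
    using order_leD[OF order_le_mult[OF J(1) order_le_mult[OF J(1) P Q(1)] R(1)] _ J(2), of n]
      order_leD[OF order_le_mult[OF J(1) P order_le_mult[OF J(1) Q(1) R(1)]] _ J(2), of n]
    by (simp add: add.assoc)
next
  case False
  define e where "e = nat (a + b + c - n)"
  have n: "n = (a + b) + c - int e" "n = a + (b + c) - int e" using False by (simp_all add: e_def)
  note PQ = order_le_mult[OF J(1) P Q(1)] and QR = order_le_mult[OF J(1) Q(1) R(1)]
  define G where "G p r q h l s = P (a - int p) x * (D1 ^^ r) (Q (b - int q)) x
      * (D1 ^^ h) ((D1 ^^ l) (R (c - int s))) x" for p r q h l s :: nat
  let ?g = "\<lambda>i l. (complex_of_int i gchoose l)"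
  let ?T5 = "{(p, r, q, m, s). p + r + q + m + s = (e::nat)}"
  have finT5: "finite ?T5"
    by (rule finite_subset[of _ "{..e} \<times> {..e} \<times> {..e} \<times> {..e} \<times> {..e}"]) auto
  have "pdo_mult (pdo_mult P Q) R n x = (\<Sum>(f, m, s)\<in>triples e. ?g (a + b - int f) m *
      (\<Sum>(p, r, q)\<in>triples f. ?g (a - int p) r * P (a - int p) x * (D1 ^^ r) (Q (b - int q)) x)
      * (D1 ^^ m) (R (c - int s)) x)"
    unfolding n(1) pdo_mult_graded[OF J PQ R(1)]
    by (simp only: pdo_mult_graded[OF J P Q(1)])
  also have "\<dots> = (\<Sum>(f, m, s)\<in>triples e. \<Sum>(p, r, q)\<in>triples f.
      ?g (a - int p) r * ?g (a + b - int f) m * G p r q 0 m s)"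
    by (simp add: sum_distrib_left sum_distrib_right case_prod_unfold G_def mult_ac)
  also have "\<dots> = (\<Sum>((f, m, s), (p, r, q))\<in>Sigma (triples e) (\<lambda>(f, m, s). triples f).
      ?g (a - int p) r * ?g (a + b - int f) m * G p r q 0 m s)"
    by (subst sum.Sigma[symmetric]) (auto simp: case_prod_unfold)
  also have "\<dots> = (\<Sum>(p, r, q, m, s)\<in>?T5. ?g (a - int p) r * ?g (a + b - int p - int r - int q) m * G p r q 0 m s)"
    by (rule sum.reindex_bij_witness[of _ "\<lambda>(p, r, q, m, s). ((p + r + q, m, s), (p, r, q))"
        "\<lambda>((f, m, s), (p, r, q)). (p, r, q, m, s)"]) (auto simp: triples_def algebra_simps)
  \<comment> \<open>The m derivatives on R are divided into l coming from Q and h coming from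
    P.\<close>
  also have "\<dots> = (\<Sum>(p, r, q, m, s)\<in>?T5. \<Sum>(l, h)\<in>{(l, h). l + h = m}.
      ?g (a - int p) (r + h) * of_nat ((r + h) choose r) * ?g (b - int q) l * G p r q h l s)"
  proof (rule sum.cong[OF refl], clarify)
    fix p r q m s
    have "?g (a - int p) r * ?g (a + b - int p - int r - int q) m
        = (\<Sum>(l, h)\<in>{(l, h). l + h = m}. ?g (a - int p) (r + h) * of_nat ((r + h) choose r) * ?g (b - int q) l)"
      unfolding gbinomial_convolution by (simp add: algebra_simps)
    then have "?g (a - int p) r * ?g (a + b - int p - int r - int q) m * G p r q 0 m s
        = (\<Sum>(l, h)\<in>{(l, h). l + h = m}. ?g (a - int p) (r + h) * of_nat ((r + h) choose r) * ?g (b - int q) l * G p r q 0 m s)"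
      by (simp add: sum_distrib_right case_prod_unfold)
    also have "\<dots> = (\<Sum>(l, h)\<in>{(l, h). l + h = m}. ?g (a - int p) (r + h) * of_nat ((r + h) choose r) * ?g (b - int q) l * G p r q h l s)"
      by (rule sum.cong) (auto simp: G_def D1_funpow_funpow add.commute)
    finally show "?g (a - int p) r * ?g (a + b - int p - int r - int q) m * G p r q 0 m s
        = (\<Sum>(l, h)\<in>{(l, h). l + h = m}. ?g (a - int p) (r + h) * of_nat ((r + h) choose r) * ?g (b - int q) l * G p r q h l s)" .
  qed
  also have "\<dots> = (\<Sum>((p, r, q, m, s), (l, h))\<in>Sigma ?T5 (\<lambda>(p, r, q, m, s). {(l, h). l + h = m}).
      ?g (a - int p) (r + h) * of_nat ((r + h) choose r) * ?g (b - int q) l * G p r q h l s)"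
  proof -
    have "finite {(l, h). l + h = m}" for m :: nat
      by (rule finite_subset[of _ "{..m} \<times> {..m}"]) auto
    then show ?thesis using finT5 by (subst sum.Sigma[symmetric]) (auto simp: case_prod_unfold)
  qed
  \<comment> \<open>Regrouping by k = r + h, the number of derivatives produced by P, prepares the
    Leibniz rule.\<close>
  also have "\<dots> = (\<Sum>((p, k, f), (q, l, s), r)\<in>Sigma (triples e) (\<lambda>(p, k, f). triples f \<times> {..k}).
      ?g (a - int p) k * of_nat (k choose r) * ?g (b - int q) l * G p r q (k - r) l s)"
    by (rule sum.reindex_bij_witness[of _ "\<lambda>((p, k, f), (q, l, s), r). ((p, r, q, l + (k - r), s), (l, k - r))"
        "\<lambda>((p, r, q, m, s), (l, h)). ((p, r + h, q + l + s), (q, l, s), r)"]) (auto simp: triples_def)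
  also have "\<dots> = (\<Sum>(p, k, f)\<in>triples e. \<Sum>(q, l, s)\<in>triples f. \<Sum>r\<le>k.
      ?g (a - int p) k * of_nat (k choose r) * ?g (b - int q) l * G p r q (k - r) l s)"
    by (subst sum.Sigma[symmetric]) (auto simp: case_prod_unfold sum.cartesian_product)
  also have "\<dots> = (\<Sum>(p, k, f)\<in>triples e. ?g (a - int p) k * P (a - int p) x *
      (\<Sum>(q, l, s)\<in>triples f. ?g (b - int q) l * (D1 ^^ k) (\<lambda>x. Q (b - int q) x * (D1 ^^ l) (R (c - int s)) x) x))"
  proof -
    have D: "(D1 ^^ k) (\<lambda>x. Q (b - int q) x * (D1 ^^ l) (R (c - int s)) x) x =
       (\<Sum>r\<le>k. of_nat (k choose r) * (D1 ^^ r) (Q (b - int q)) x * (D1 ^^ (k - r)) ((D1 ^^ l) (R (c - int s))) x)" for k q l s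
      using Q(2) R(2)
      by (subst D1_funpow_mult[OF J(1) _ _ J(2)])
         (auto simp: inf_diff_pdo_def intro!: inf_diff_on_D1_funpow)
    show ?thesis unfolding D
      by (simp add: sum_distrib_left case_prod_unfold G_def mult_ac)
  qed
  also have "\<dots> = (\<Sum>(p, k, f)\<in>triples e. ?g (a - int p) k * P (a - int p) x *
      (D1 ^^ k) (pdo_mult Q R (b + c - int f)) x)"
  proof -
    have "(D1 ^^ k) (pdo_mult Q R (b + c - int f)) x = (\<Sum>(q, l, s)\<in>triples f. ?g (b - int q) l *
       (D1 ^^ k) (\<lambda>x. Q (b - int q) x * (D1 ^^ l) (R (c - int s)) x) x)" for k f
    proof -
      have sm: "inf_diff_on J (\<lambda>x. Q (b - int q) x * (D1 ^^ l) (R (c - int s)) x)" for q l s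
        using Q(2) R(2) by (auto simp: inf_diff_pdo_def intro!: inf_diff_on_mult J(1) inf_diff_on_D1_funpow)
      have "(D1 ^^ k) (pdo_mult Q R (b + c - int f)) x = (D1 ^^ k) (\<lambda>x. \<Sum>z\<in>triples f.
          (case z of (q, l, s) \<Rightarrow> ?g (b - int q) l * (Q (b - int q) x * (D1 ^^ l) (R (c - int s)) x))) x"
        by (rule D1_funpow_cong[OF J(1) _ J(2)])
           (subst pdo_mult_graded[OF J(1) _ Q(1) R(1)], auto simp: mult_ac)
      also have "\<dots> = (\<Sum>z\<in>triples f. (D1 ^^ k) (\<lambda>x. case z of (q, l, s) \<Rightarrow>
          ?g (b - int q) l * (Q (b - int q) x * (D1 ^^ l) (R (c - int s)) x)) x)"
        using sm by (intro D1_funpow_sum[OF J(1) _ J(2)]) (auto intro!: inf_diff_on_mult[OF J(1) inf_diff_on_const sm] split: prod.split)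
      also have "\<dots> = (\<Sum>(q, l, s)\<in>triples f. ?g (b - int q) l *
          (D1 ^^ k) (\<lambda>x. Q (b - int q) x * (D1 ^^ l) (R (c - int s)) x) x)"
        by (rule sum.cong[OF refl]) (clarsimp, rule D1_funpow_cmult[OF J(1) sm J(2), simplified])
      finally show ?thesis .
    qed
    then show ?thesis by simp
  qed
  also have "\<dots> = pdo_mult P (pdo_mult Q R) n x"
    unfolding n(2) pdo_mult_graded[OF J P QR] ..
  finally show ?thesis .
qed

section \<open>Composition with derivations and with \<open>D\<^sub>N\<close>\<close>

lemma D1_funpow_const: "(D1 ^^ l) (\<lambda>x. c) x = (if l = 0 then c else 0)"
proof (cases l)
  case (Suc m)
  show ?thesis unfolding Suc funpow_Suc_right o_def D1_const by simp
qed simp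

lemma inf_diff_pdo_pow_dx [simp]: "inf_diff_pdo J (pdo_pow_dx k)"
  by (simp add: inf_diff_pdo_def pdo_pow_dx_def)

lemma order_le_pow_dx: "order_le J k (pdo_pow_dx k)"
  by (simp add: order_le_def pdo_pow_dx_def)

lemma pdo_mult_pow_dx_right: "pdo_mult P (pdo_pow_dx k) n x = P (n - k) x"
proof -
  let ?f = "\<lambda>(i::int, l::nat). (of_int i gchoose l) * P i x * (D1 ^^ l) (pdo_pow_dx k (n - i + int l)) x"
  have z: "?f il = 0" if "il \<notin> {(n - k, 0)}" for il
    using that by (cases il; cases "snd il") (auto simp: pdo_pow_dx_def D1_funpow_const simp del: funpow.simps)
  have "Sum_any ?f = sum ?f {(n - k, 0)}"
    using z by (intro Sum_any.expand_superset) auto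
  then show ?thesis by (simp add: pdo_mult_def) (simp add: pdo_pow_dx_def)
qed

lemma pdo_mult_one_left: "pdo_mult (pdo_pow_dx 0) P n x = P n x"
proof -
  let ?f = "\<lambda>(i::int, l::nat). (of_int i gchoose l) * pdo_pow_dx 0 i x * (D1 ^^ l) (P (n - i + int l)) x"
  have z: "?f il = 0" if "il \<notin> {(0, 0)}" for il
    using that by (cases il; cases "snd il") (auto simp: pdo_pow_dx_def)
  have "Sum_any ?f = sum ?f {(0, 0)}"
    using z by (intro Sum_any.expand_superset) auto
  then show ?thesis by (simp add: pdo_mult_def) (simp add: pdo_pow_dx_def)
qed

text \<open>Left composition with \<partial>, by the product rule. Its iterates give a finite
  description of left multiplication by differential operators.\<close>

definition pdo_dx :: "pdo \<Rightarrow> pdo" where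
  "pdo_dx P = (\<lambda>n x. D1 (P n) x + P (n - 1) x)"

lemma inf_diff_pdo_dx: "open J \<Longrightarrow> inf_diff_pdo J P \<Longrightarrow> inf_diff_pdo J (pdo_dx P)"
  by (simp add: inf_diff_pdo_def pdo_dx_def inf_diff_on_add inf_diff_on_D1)

lemma inf_diff_pdo_dx_funpow: "open J \<Longrightarrow> inf_diff_pdo J P \<Longrightarrow> inf_diff_pdo J ((pdo_dx ^^ i) P)"
  by (induction i) (auto intro: inf_diff_pdo_dx)

lemma pdo_dx_funpow:
  assumes "open J" "inf_diff_pdo J P" "x \<in> J"
  shows "(pdo_dx ^^ i) P n x = (\<Sum>l\<le>i. of_nat (i choose l) * (D1 ^^ l) (P (n - int i + int l)) x)"
  using assms(2)
proof (induction i arbitrary: P)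
  case (Suc i)
  have sm: "inf_diff_on J (P m)" for m using Suc.prems by (simp add: inf_diff_pdo_def)
  let ?t = "\<lambda>l. (D1 ^^ l) (P (n - int (Suc i) + int l)) x"
  have "(pdo_dx ^^ Suc i) P n x = (\<Sum>l\<le>i. of_nat (i choose l) * (D1 ^^ l) (pdo_dx P (n - int i + int l)) x)"
    unfolding funpow_Suc_right o_def by (rule Suc.IH[OF inf_diff_pdo_dx[OF assms(1) Suc.prems]])
  also have "\<dots> = (\<Sum>l\<le>i. of_nat (i choose l) * (?t (Suc l) + ?t l))"
  proof (rule sum.cong[OF refl])
    fix l
    have "(D1 ^^ l) (pdo_dx P (n - int i + int l)) x =
        (D1 ^^ l) (D1 (P (n - int i + int l))) x + (D1 ^^ l) (P (n - int i + int l - 1)) x"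
      unfolding pdo_dx_def by (rule D1_funpow_add[OF assms(1) inf_diff_on_D1[OF sm] sm assms(3)])
    also have "\<dots> = ?t (Suc l) + ?t l"
      by (simp add: funpow_swap1) (simp add: algebra_simps)
    finally show "of_nat (i choose l) * (D1 ^^ l) (pdo_dx P (n - int i + int l)) x = of_nat (i choose l) * (?t (Suc l) + ?t l)"
      by simp
  qed
  also have "\<dots> = (\<Sum>l\<le>i. of_nat (i choose l) * ?t (Suc l)) + (\<Sum>l\<le>Suc i. of_nat (i choose l) * ?t l)"
    by (simp add: sum.distrib distrib_left)
  also have "(\<Sum>l\<le>Suc i. of_nat (i choose l) * ?t l) = ?t 0 + (\<Sum>l\<le>i. of_nat (i choose Suc l) * ?t (Suc l))"
    by (subst sum.atMost_Suc_shift) simp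
  also have "(\<Sum>l\<le>i. of_nat (i choose l) * ?t (Suc l)) + (?t 0 + (\<Sum>l\<le>i. of_nat (i choose Suc l) * ?t (Suc l)))
     = ?t 0 + (\<Sum>l\<le>i. of_nat (Suc i choose Suc l) * ?t (Suc l))"
    by (simp add: sum.distrib[symmetric] distrib_right)
  also have "\<dots> = (\<Sum>l\<le>Suc i. of_nat (Suc i choose l) * ?t l)"
    by (simp only: sum.atMost_Suc_shift binomial_n_0 of_nat_1 mult_1_left)
  finally show ?case .
qed simp

text \<open>Each application reaches one order further down. This allows an operator to be replaced
  by a truncation that is correct only from order \<open>n - int i\<close> upwards.\<close>

lemma pdo_dx_funpow_cong:
  assumes "open J" "\<And>m z. m \<ge> n - int i \<Longrightarrow> z \<in> J \<Longrightarrow> P m z = P' m z" "x \<in> J"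
  shows "(pdo_dx ^^ i) P n x = (pdo_dx ^^ i) P' n x"
  using assms(2,3)
proof (induction i arbitrary: n x)
  case (Suc i)
  have "D1 ((pdo_dx ^^ i) P n) x = D1 ((pdo_dx ^^ i) P' n) x"
    by (rule differentiable_cong_open(2)[OF assms(1) _ Suc.prems(2)]) (rule Suc.IH, use Suc.prems in auto)
  moreover have "(pdo_dx ^^ i) P (n - 1) x = (pdo_dx ^^ i) P' (n - 1) x"
    by (rule Suc.IH) (use Suc.prems in auto)
  moreover have "(pdo_dx ^^ Suc i) Q n x = D1 ((pdo_dx ^^ i) Q n) x + (pdo_dx ^^ i) Q (n - 1) x" for Q
    by (simp only: funpow.simps o_def pdo_dx_def[of "(pdo_dx ^^ i) Q"])
  ultimately show ?case by (simp only:)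
qed simp

text \<open>Left multiplication by \<open>L_op N u\<close>, written in the shape of
  \<open>hk_L\<close> with \<open>pdo_dx\<close> in place of \<open>hk_dx\<close>, so that the two
  can be matched term by term.\<close>

definition L_act :: "nat \<Rightarrow> (nat \<Rightarrow> real \<Rightarrow> complex) \<Rightarrow> pdo \<Rightarrow> pdo" where
  "L_act N u P = (\<lambda>n x. (pdo_dx ^^ N) P n x + (\<Sum>i\<le>N - 2. u i x * (pdo_dx ^^ i) P n x))"

lemma pdo_mult_L_op:
  assumes "N \<ge> 2" "open J" "inf_diff_pdo J P" "x \<in> J"
  shows "pdo_mult (L_op N u) P n x = L_act N u P n x"
proof -
  let ?f = "\<lambda>(i::int, l::nat). (of_int i gchoose l) * L_op N u i x * (D1 ^^ l) (P (n - i + int l)) x"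
  let ?S = "Sigma {..N} (\<lambda>i. {..i})" and ?h = "\<lambda>(i::nat, l::nat). (int i, l)"
  have "{il. ?f il \<noteq> 0} \<subseteq> ?h ` ?S"
  proof
    fix il assume "il \<in> {il. ?f il \<noteq> 0}"
    then obtain i l where il: "il = (i, l)" "?f (i, l) \<noteq> 0" by (cases il) auto
    then have i: "0 \<le> i" "i \<le> int N" by (auto simp: L_op_def split: if_splits)
    \<comment> \<open>For i \<ge> 0 the generalized binomial is an ordinary one and vanishes for l >
      i, which makes the support finite.\<close>
    then have "of_int i = (of_nat (nat i) :: complex)" by simp
    then have "(of_int i gchoose l) = (of_nat (nat i choose l) :: complex)"
      by (simp only: binomial_gbinomial)
    then have "l \<le> nat i" using il(2) by (metis (no_types, lifting) binomial_eq_0 case_prod_conv mult_zero_left not_le of_nat_0)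
    then show "il \<in> ?h ` ?S"
      using i by (intro image_eqI[of _ _ "(nat i, l)"]) (auto simp: il(1))
  qed
  then have "pdo_mult (L_op N u) P n x = sum ?f (?h ` ?S)"
    unfolding pdo_mult_def by (intro Sum_any.expand_superset) auto
  also have "\<dots> = (\<Sum>(i, l)\<in>?S. of_nat (i choose l) * L_op N u (int i) x * (D1 ^^ l) (P (n - int i + int l)) x)"
    by (subst sum.reindex) (auto simp: inj_on_def case_prod_unfold binomial_gbinomial o_def)
  also have "\<dots> = (\<Sum>i\<le>N. L_op N u (int i) x * (pdo_dx ^^ i) P n x)"
    by (subst sum.Sigma[symmetric]) (auto simp: pdo_dx_funpow[OF assms(2-4)] sum_distrib_left mult_ac)
  \<comment> \<open>Order N - 1 is listed separately because the coefficient of L there is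
    0.\<close>
  also have "{..N} = insert N (insert (N - 1) {..N - 2})" using assms(1) by auto
  also have "(\<Sum>i\<in>insert N (insert (N - 1) {..N - 2}). L_op N u (int i) x * (pdo_dx ^^ i) P n x) =
      (pdo_dx ^^ N) P n x + (\<Sum>i\<le>N - 2. L_op N u (int i) x * (pdo_dx ^^ i) P n x)"
  proof -
    have "N \<notin> insert (N - 1) {..N - 2}" "N - 1 \<notin> {..N - 2}" using assms(1) by auto
    then show ?thesis using assms(1) by (simp add: L_op_def)
  qed
  also have "(\<Sum>i\<le>N - 2. L_op N u (int i) x * (pdo_dx ^^ i) P n x) = (\<Sum>i\<le>N - 2. u i x * (pdo_dx ^^ i) P n x)"
    using assms(1) by (intro sum.cong) (auto simp: L_op_def)
  finally show ?thesis by (simp add: L_act_def)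
qed

lemma L_act_cong:
  assumes "open J" "\<And>m z. m \<ge> n - int N \<Longrightarrow> z \<in> J \<Longrightarrow> P m z = P' m z" "x \<in> J"
  shows "L_act N u P n x = L_act N u P' n x"
proof -
  have "(pdo_dx ^^ i) P n x = (pdo_dx ^^ i) P' n x" if "i \<le> N" for i
    by (rule pdo_dx_funpow_cong[OF assms(1) _ assms(3)]) (use assms(2) that in auto)
  then show ?thesis by (simp add: L_act_def)
qed

section \<open>Right multiplication by \<open>D_N\<close> and the operators
  \<open>\<partial>^j D_N^k\<close>\<close>

lemma pdo_mult_D_op_right:
  "pdo_mult P (D_op N y) n x = - (of_real (x - y) * P (n + int N - 1) x + of_int (n + 1) * P (n + int N) x)"
proof -
  let ?f = "\<lambda>(i::int, l::nat). (of_int i gchoose l) * P i x * (D1 ^^ l) (D_op N y (n - i + int l)) x"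
  \<comment> \<open>The coefficients of \<open>D_N\<close> are affine in x, so at most one
    derivative survives.\<close>
  let ?A = "{(n + int N - 1, 0), (n + int N, 0), (n + int N, Suc 0)}"
  have D1m: "D1 (\<lambda>x. - complex_of_real (x - y)) = (\<lambda>x. - 1)" 
    using D1_mult[of "\<lambda>_. - 1", OF _ inf_diff_on_differentiable[OF inf_diff_on_of_real[of UNIV y]]]
    by (auto simp: D1_of_real_diff simp del: of_real_diff)
  have D: "D_op N y m = (if m = 1 - int N then (\<lambda>x. - of_real (x - y)) else (\<lambda>x. if m = - int N then of_nat N - 1 else 0))" for m
    by (auto simp: D_op_eq)
  have Dl: "(D1 ^^ l) (D_op N y m) x = (if m = 1 - int N then (if l = 0 then - of_real (x - y) else if l = 1 then - 1 else 0)
      else if l = 0 \<and> m = - int N then of_nat N - 1 else 0)" for l m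
  proof (cases l)
    case (Suc l')
    show ?thesis unfolding D Suc funpow_Suc_right o_def by (simp add: D1m D1_funpow_const del: of_real_diff)
  qed (simp add: D)
  have z: "?f il = 0" if "il \<notin> ?A" for il
  proof -
    obtain i l where il: "il = (i, l)" by (cases il)
    show ?thesis using that unfolding il Dl prod.case by (auto simp: algebra_simps)
  qed
  have "{il. ?f il \<noteq> 0} \<subseteq> ?A" using z by blast
  then have "pdo_mult P (D_op N y) n x = sum ?f ?A"
    unfolding pdo_mult_def by (intro Sum_any.expand_superset) simp
  \<comment> \<open>The factor -(n + 1) is N - 1 minus n + N. At x = y and n = -1 the whole
    expression is 0, which is the vanishing of residues of operators \<open>P D_N\<close>.\<close>
  also have "\<dots> = - (of_real (x - y) * P (n + int N - 1) x + of_int (n + 1) * P (n + int N) x)"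
    unfolding Dl by (simp add: Dl algebra_simps)
  finally show ?thesis .
qed

lemma D_op_smooth: "inf_diff_pdo UNIV (D_op N y)" "order_le UNIV (1 - int N) (D_op N y)"
proof -
  have "inf_diff_on UNIV (D_op N y i)" for i
  proof (cases "i = 1 - int N")
    case True
    then show ?thesis
      using inf_diff_on_mult[OF open_UNIV inf_diff_on_const[of UNIV "- 1"] inf_diff_on_of_real[of UNIV y]]
      by (simp add: D_op_eq)
  qed (simp add: D_op_eq)
  then show "inf_diff_pdo UNIV (D_op N y)" by (simp add: inf_diff_pdo_def)
  show "order_le UNIV (1 - int N) (D_op N y)" by (simp add: order_le_def D_op_eq)
qed

lemma pdo_power_D_op_smooth:
  "inf_diff_pdo UNIV (pdo_power (D_op N y) k) \<and> order_le UNIV (int k * (1 - int N)) (pdo_power (D_op N y) k)"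
proof (induction k)
  case 0
  then show ?case using order_le_pow_dx[of UNIV 0] by simp
next
  case (Suc k)
  then show ?case
    using inf_diff_pdo_mult[OF open_UNIV D_op_smooth(2) _ D_op_smooth(1)]
      order_le_mult[OF open_UNIV D_op_smooth(2)]
    by (fastforce simp: algebra_simps)
qed

text \<open>\<open>pdo_power\<close> adds factors on the left; associativity moves the new factor to
  the right, where \<open>pdo_mult_D_op_right\<close> applies.\<close>

lemma pdo_power_D_op_Suc: "pdo_power (D_op N y) (Suc k) = pdo_mult (pdo_power (D_op N y) k) (D_op N y)"
proof (induction k)
  case 0
  show ?case by (intro ext) (simp add: pdo_mult_one_left pdo_mult_pow_dx_right)
next
  case (Suc k)
  have "pdo_power (D_op N y) (Suc (Suc k)) = pdo_mult (D_op N y) (pdo_mult (pdo_power (D_op N y) k) (D_op N y))"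
    by (simp only: pdo_power.simps(2)[of _ "Suc k"] Suc.IH)
  also have "\<dots> = pdo_mult (pdo_mult (D_op N y) (pdo_power (D_op N y) k)) (D_op N y)"
    using pdo_mult_assoc[OF open_UNIV UNIV_I D_op_smooth(2) conjunct2[OF pdo_power_D_op_smooth]
        conjunct1[OF pdo_power_D_op_smooth] D_op_smooth(2,1)]
    by (intro ext) simp
  finally show ?case by simp
qed

text \<open>The coefficient of \<open>\<partial>\<^sup>n\<close> in \<open>c\<^sup>k \<partial>\<^sup>j D\<^sub>N\<^sup>k\<close> as a function of \<open>d = x - y\<close>; see \<open>airy_op_eq\<close> below.\<close>
fun airy_op :: "nat \<Rightarrow> complex \<Rightarrow> complex \<Rightarrow> nat \<Rightarrow> nat \<Rightarrow> int \<Rightarrow> complex" where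
  "airy_op N c d j 0 n = (if n = int j then 1 else 0)"
| "airy_op N c d j (Suc k) n =
     - c * (d * airy_op N c d j k (n + int N - 1) + of_int (n + 1) * airy_op N c d j k (n + int N))"

lemma airy_op_eq:
  "airy_op N c (of_real (x - y)) j k n = c ^ k * pdo_mult (pdo_pow_dx (int j)) (pdo_power (D_op N y) k) n x"
proof (induction k arbitrary: n)
  case 0
  show ?case by (simp add: pdo_mult_pow_dx_right) (simp add: pdo_pow_dx_def)
next
  case (Suc k)
  have "pdo_mult (pdo_pow_dx (int j)) (pdo_power (D_op N y) (Suc k)) n x =
      pdo_mult (pdo_mult (pdo_pow_dx (int j)) (pdo_power (D_op N y) k)) (D_op N y) n x"
    unfolding pdo_power_D_op_Suc
    using pdo_mult_assoc[OF open_UNIV UNIV_I order_le_pow_dx conjunct2[OF pdo_power_D_op_smooth]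
        conjunct1[OF pdo_power_D_op_smooth] D_op_smooth(2,1)] by simp
  then show ?case
    unfolding airy_op.simps Suc.IH pdo_mult_D_op_right by (simp only:) (simp add: algebra_simps)
qed

lemma airy_op_eq_0:
  assumes "n > int j - int k * (int N - 1)"
  shows "airy_op N c d j k n = 0"
  using assms by (induction k arbitrary: n) (auto simp: algebra_simps)

text \<open>Since N - 1 \<ge> 1, the order is at most j - k; this weaker bound is linear and easier
  to use for truncations.\<close>

lemma airy_op_eq_0':
  assumes "N \<ge> 2" "n > int j - int k"
  shows "airy_op N c d j k n = 0"
proof (rule airy_op_eq_0)
  have "int k * 1 \<le> int k * (int N - 1)" using assms(1) by (intro mult_left_mono) auto
  then show "n > int j - int k * (int N - 1)" using assms(2) by linarith
qed

text \<open>The Airy relation for operators: \<open>\<partial>^(N-1+m) D_N\<close> is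
  \<open>- \<partial>^m\<close> composed with multiplication by x - y, that is,
  \<open>- (x - y) \<partial>^m - m \<partial>^(m-1)\<close>. The remaining \<open>D_N^k\<close>
  stands on the right, which is what the induction adds.\<close>

lemma airy_op_shift:
  assumes "N \<ge> 2"
  shows "airy_op N c d (N - 1 + m) (Suc k) n
    = - c * (d * airy_op N c d m k n + of_nat m * airy_op N c d (m - 1) k n)"
proof (induction k arbitrary: n)
  case 0
  \<comment> \<open>For m = 0 the truncated index m - 1 is harmless because its factor m is 0; on
    the other side n = -1 has the factor n + 1 = 0.\<close>
  show ?case using assms by (cases m; cases "n = - 1") (auto simp: of_nat_diff algebra_simps)
next
  case (Suc k)
  show ?case
    unfolding airy_op.simps(2)[of _ _ _ _ "Suc k"] Suc.IH airy_op.simps(2)[of _ _ _ m k] airy_op.simps(2)[of _ _ _ "m - 1" k]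
    by (simp add: algebra_simps)
qed

text \<open>Euler's identity: by \<open>airy_op_dx\<close> the bracket is the derivative in d, and
  the coefficient is homogeneous in d of degree n + k N - j, as seen by giving x - y weight 1 and
  \<partial> weight -1.\<close>

lemma airy_op_euler:
  "d * (airy_op N c d (Suc j) k n - airy_op N c d j k (n - 1))
    = of_int (n + int k * int N - int j) * airy_op N c d j k n"
proof (induction k arbitrary: n)
  case 0
  show ?case by auto
next
  case (Suc k)
  let ?b = "\<lambda>j n. airy_op N c d j k n"
  have "d * (airy_op N c d (Suc j) (Suc k) n - airy_op N c d j (Suc k) (n - 1))
     = - c * (d * (d * (?b (Suc j) (n + int N - 1) - ?b j (n + int N - 1 - 1)))
        + of_int (n + 1) * (d * (?b (Suc j) (n + int N) - ?b j (n + int N - 1))) + d * ?b j (n + int N - 1))"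
    by (simp add: algebra_simps)
  also have "\<dots> = of_int (n + int (Suc k) * int N - int j) * airy_op N c d j (Suc k) n"
    unfolding Suc.IH by (simp add: algebra_simps)
  finally show ?case .
qed

text \<open>Composing \<open>c^k \<partial>^j D_N^k\<close> with \<partial> on the left raises j by
  one, just as differentiation in x turns \<open>a_j\<close> into \<open>a_(j+1)\<close>.\<close>

lemma airy_op_dx:
  "inf_diff_on UNIV (\<lambda>x. airy_op N c (of_real (x - y)) j k n) \<and>
   D1 (\<lambda>x. airy_op N c (of_real (x - y)) j k n) x + airy_op N c (of_real (x - y)) j k (n - 1)
     = airy_op N c (of_real (x - y)) (Suc j) k n"
proof (induction k arbitrary: n)
  case 0
  show ?case by simp
next
  case (Suc k)
  let ?b = "\<lambda>j n x. airy_op N c (of_real (x - y)) j k n"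
  have sm: "inf_diff_on UNIV (?b j n)" for n using Suc by blast
  have dd: "f differentiable (at x)" if "inf_diff_on UNIV f" for f x
    using inf_diff_on_differentiable[OF that] by simp
  note I = inf_diff_on_of_real[of UNIV y] inf_diff_on_add[OF open_UNIV] inf_diff_on_mult[OF open_UNIV] sm inf_diff_on_const
  have "D1 (\<lambda>x. airy_op N c (of_real (x - y)) j (Suc k) n) x =
     - c * (?b j (n + int N - 1) x + of_real (x - y) * D1 (?b j (n + int N - 1)) x + of_int (n + 1) * D1 (?b j (n + int N)) x)"
    unfolding airy_op.simps
    apply (subst D1_mult)
      apply (rule dd, intro I)
     apply (rule dd, intro I)
    apply (subst D1_add)
      apply (rule dd, intro I)
     apply (rule dd, intro I)
    apply (subst D1_mult)
      apply (rule dd, intro I)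
     apply (rule dd, intro I)
    apply (subst D1_mult)
      apply (rule dd, intro I)
     apply (rule dd, intro I)
    apply (simp add: D1_of_real_diff del: of_real_diff)
    done
  moreover have "D1 (?b j m) x = ?b (Suc j) m x - ?b j (m - 1) x" for m
    using Suc[of m] by (simp add: algebra_simps)
  moreover have "inf_diff_on UNIV (\<lambda>x. airy_op N c (of_real (x - y)) j (Suc k) n)"
    unfolding airy_op.simps by (intro I)
  ultimately show ?case by (simp add: algebra_simps del: of_real_diff)
qed

text \<open>The operator counterpart of \<open>airy_coeff_sound\<close>. Each use of the Airy
  relation consumes one factor \<open>D_N\<close> where the expansion gains a factor 1/t;
  \<open>n \<le> K\<close> guarantees that enough factors are present and that K - p is never
  truncated.\<close>

lemma airy_op_reduce:
  assumes "N \<ge> 2" and c: "c = \<kappa> / of_nat N" and "i \<le> n" "n \<le> K"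
  shows "airy_op N c d i K m = (\<Sum>p\<le>n. \<Sum>j\<le>N - 2. airy_coeff N \<kappa> d p i j * airy_op N c d j (K - p) m)"
  using assms(3,4)
proof (induction n arbitrary: i K)
  case 0
  then show ?case using assms(1) by (simp add: if_distrib[of "\<lambda>c. c * _"] cong: if_cong)
next
  case (Suc n)
  define R where "R p i K = (\<Sum>j\<le>N - 2. airy_coeff N \<kappa> d p i j * airy_op N c d j (K - p) m)" for p i K
  show ?case
  proof (cases "i + 1 < N")
    case True
    have "R (Suc p) i K = 0" for p using True by (simp add: R_def)
    moreover have "R 0 i K = (\<Sum>j\<le>N-2. if i = j then airy_op N c d j K m else 0)"
      using True unfolding R_def by (intro sum.cong) auto
    then have "R 0 i K = airy_op N c d i K m" using True by simp
    ultimately show ?thesis unfolding R_def[symmetric] by (simp add: sum.atMost_Suc_shift del: sum.atMost_Suc)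
  next
    case False
    let ?m = "i + 1 - N"
    have m: "i = N - 1 + ?m" "i - N = ?m - 1" using False assms(1) by auto
    obtain K' where K: "K = Suc K'" using Suc.prems by (cases K) auto
    have R0: "R 0 i K = 0" using False by (simp add: R_def)
    have distr: "k * (d * c + m * c') * b = k * (d * (c * b) + m * (c' * b))"
      for k d c m c' b :: complex
      by (simp add: algebra_simps)
    have RS: "R (Suc p) i K = - c * (d * R p ?m K' + of_nat ?m * R p (i - N) K')" for p
      using False unfolding R_def sum_distrib_left sum.distrib[symmetric] c K
      by (intro sum.cong refl) (simp only: airy_coeff.simps if_False distr diff_Suc_Suc)
    have "airy_op N c d i K m = - c * (d * airy_op N c d ?m K' m + of_nat ?m * airy_op N c d (i - N) K' m)"
      using airy_op_shift[OF assms(1), of c d ?m K' m] unfolding m(1)[symmetric] m(2)[symmetric] K .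
    also have "airy_op N c d ?m K' m = (\<Sum>p\<le>n. R p ?m K')"
      unfolding R_def using Suc.prems assms(1) K by (intro Suc.IH) auto
    also have "airy_op N c d (i - N) K' m = (\<Sum>p\<le>n. R p (i - N) K')"
      unfolding R_def using Suc.prems assms(1) K by (intro Suc.IH) auto
    also have "- c * (d * (\<Sum>p\<le>n. R p ?m K') + of_nat ?m * (\<Sum>p\<le>n. R p (i - N) K')) = (\<Sum>p\<le>n. R (Suc p) i K)"
      unfolding RS sum_distrib_left sum.distrib[symmetric] ..
    finally show ?thesis unfolding R_def[symmetric] by (simp add: R0 sum.atMost_Suc_shift del: sum.atMost_Suc)
  qed
qed

section \<open>Wave functions\<close>

lemma pdo_onD:
  assumes "open I" "pdo_on I P"
  shows "inf_diff_pdo I P" and "\<exists>m. order_le I m P"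
  using assms smooth_on_imp_inf_diff_on by (auto simp: pdo_on_def inf_diff_pdo_def order_le_def)

text \<open>Multiplying \<open>L = S \<partial>^N S^-1\<close> by S on the right gives
  \<open>L S = S \<partial>^N\<close>; on coefficients, right multiplication by
  \<open>\<partial>^N\<close> is a shift of the order by N.\<close>

lemma wave_operator_L_act:
  assumes "N \<ge> 2" "open I" "wave_operator_on I N u S" "x \<in> I"
  shows "L_act N u S n x = S (n - int N) x"
proof -
  obtain Sinv where S: "pdo_on I S" and inv: "pdo_inverse_on I S Sinv"
    and L: "pdo_eq_on I (L_op N u) (pdo_mult (pdo_mult S (pdo_pow_dx (int N))) Sinv)"
    using assms(3) by (auto simp: wave_operator_on_def)
  have Sinv: "pdo_on I Sinv" using inv by (simp add: pdo_inverse_on_def)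
  obtain a where a: "order_le I a S" using pdo_onD(2)[OF assms(2) S] ..
  obtain b where b: "order_le I b Sinv" using pdo_onD(2)[OF assms(2) Sinv] ..
  let ?A = "pdo_mult S (pdo_pow_dx (int N))"
  have "L_act N u S n x = pdo_mult (L_op N u) S n x"
    using pdo_mult_L_op[OF assms(1,2) pdo_onD(1)[OF assms(2) S] assms(4)] by simp
  also have "\<dots> = pdo_mult (pdo_mult ?A Sinv) S n x"
    using L assms(4) by (intro pdo_mult_cong[OF assms(2,4)]) (auto simp: pdo_eq_on_def)
  also have "\<dots> = pdo_mult ?A (pdo_mult Sinv S) n x"
    by (rule pdo_mult_assoc[OF assms(2,4) order_le_mult[OF assms(2) a order_le_pow_dx] b pdo_onD(1)[OF assms(2) Sinv]
        a pdo_onD(1)[OF assms(2) S]])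
  also have "\<dots> = pdo_mult ?A (pdo_pow_dx 0) n x"
    using inv by (intro pdo_mult_cong[OF assms(2,4)]) (auto simp: pdo_eq_on_def pdo_inverse_on_def)
  finally show ?thesis by (simp add: pdo_mult_pow_dx_right)
qed

section \<open>The adjoint and its left inverse\<close>

lemma pdo_mult_pow_dx_fun:
  "pdo_mult (pdo_pow_dx i) (pdo_fun f) n x
    = (if n \<le> i then (of_int i gchoose nat (i - n)) * (D1 ^^ nat (i - n)) f x else 0)"
proof -
  let ?f = "\<lambda>(k::int, l::nat). (of_int k gchoose l) * pdo_pow_dx i k x * (D1 ^^ l) (pdo_fun f (n - k + int l)) x"
  have D: "(D1 ^^ l) (pdo_fun f m) x = (if m = 0 then (D1 ^^ l) f x else 0)" for l m
    by (simp add: pdo_fun_def)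
  have z: "?f kl = 0" if "kl \<notin> {(i, nat (i - n))} \<or> n > i" for kl
    using that by (cases kl) (auto simp: pdo_pow_dx_def D)
  have "{kl. ?f kl \<noteq> 0} \<subseteq> {(i, nat (i - n))}" using z by blast
  then have "pdo_mult (pdo_pow_dx i) (pdo_fun f) n x = sum ?f {(i, nat (i - n))}"
    unfolding pdo_mult_def by (intro Sum_any.expand_superset) simp
  then show ?thesis by (simp add: D pdo_pow_dx_def)
qed

lemma pdo_adjoint_eq:
  assumes "open I" "order_le I 0 S" "x \<in> I"
  shows "pdo_adjoint S (- int q) x =
    (\<Sum>s\<le>q. (-1) ^ s * (of_int (- int s) gchoose (q - s)) * (D1 ^^ (q - s)) (S (- int s)) x)"
proof -
  let ?f = "\<lambda>i. (-1) powi i * pdo_mult (pdo_pow_dx i) (pdo_fun (S i)) (- int q) x"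
  have "{i. ?f i \<noteq> 0} \<subseteq> (\<lambda>s. - int s) ` {..q}"
  proof
    fix i assume "i \<in> {i. ?f i \<noteq> 0}"
    then have i: "- int q \<le> i" "(D1 ^^ nat (i + int q)) (S i) x \<noteq> 0"
      by (auto simp: pdo_mult_pow_dx_fun split: if_splits)
    have "i \<le> 0"
      using i(2) D1_funpow_eq_zero[OF assms(1) _ assms(3), of "S i"] order_leD[OF assms(2), of i] by force
    then show "i \<in> (\<lambda>s. - int s) ` {..q}" using i(1)
      by (intro image_eqI[of _ _ "nat (- i)"]) auto
  qed
  then have "pdo_adjoint S (- int q) x = sum ?f ((\<lambda>s. - int s) ` {..q})"
    unfolding pdo_adjoint_def by (intro Sum_any.expand_superset) auto
  also have "\<dots> = (\<Sum>s\<le>q. ?f (- int s))"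
    by (subst sum.reindex) (auto simp: inj_on_def)
  also have "\<dots> = (\<Sum>s\<le>q. (-1) ^ s * (of_int (- int s) gchoose (q - s)) * (D1 ^^ (q - s)) (S (- int s)) x)"
  proof (rule sum.cong[OF refl])
    fix s assume s: "s \<in> {..q}"
    then have "nat (- int s - - int q) = q - s" by auto
    moreover have "(-1 :: complex) powi (- int s) = (-1) ^ s"
      by (simp add: power_int_minus power_inverse[symmetric])
    ultimately show "?f (- int s) = (-1) ^ s * (of_int (- int s) gchoose (q - s)) * (D1 ^^ (q - s)) (S (- int s)) x"
      using s by (simp only: pdo_mult_pow_dx_fun) simp
  qed
  finally show ?thesis .
qed

lemma order_le_adjoint:
  assumes "open I" "order_le I 0 S"
  shows "order_le I 0 (pdo_adjoint S)"
  unfolding order_le_def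
proof (intro allI impI ballI)
  fix n :: int and x assume n: "n > 0" and x: "x \<in> I"
  have "pdo_mult (pdo_pow_dx i) (pdo_fun (S i)) n x = 0" for i
    unfolding pdo_mult_pow_dx_fun
    using D1_funpow_eq_zero[OF assms(1) _ x, of "S i"] order_leD[OF assms(2), of i] n by auto
  then show "pdo_adjoint S n x = 0" by (simp add: pdo_adjoint_def)
qed

text \<open>As A has leading coefficient 1, the coefficient of T A at the top order a of T is that
  of T itself. It is 0 for a > 0, so the order bound descends from M to 0, where the coefficient is
  1.\<close>

lemma order_le_0_of_left_inverse:
  assumes "open I" "order_le I (int M) T" "order_le I 0 A" "\<And>x. x \<in> I \<Longrightarrow> A 0 x = 1"
    and "pdo_eq_on I (pdo_mult T A) (pdo_pow_dx 0)"
  shows "order_le I 0 T" and "\<And>x. x \<in> I \<Longrightarrow> T 0 x = 1"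
proof -
  have top: "T a x = pdo_pow_dx 0 a x" if "order_le I a T" "x \<in> I" for a x
    using pdo_mult_graded[OF assms(1) that(2,1) assms(3), of 0] assms(4,5) that(2)
    by (simp add: triples_0 pdo_eq_on_def)
  show T: "order_le I 0 T"
    using assms(2)
  proof (induction M)
    case (Suc M)
    have "T (int (Suc M)) x = 0" if "x \<in> I" for x
      using top[OF Suc.prems that] by (simp add: pdo_pow_dx_def)
    then have "order_le I (int M) T"
      using Suc.prems unfolding order_le_def
      by (metis linorder_neqE_linordered_idom not_less of_nat_Suc zle_add1_eq_le add.commute)
    then show ?case by (rule Suc.IH)
  qed simp
  show "T 0 x = 1" if "x \<in> I" for x
    using top[OF T that] by (simp add: pdo_pow_dx_def)
qed

text \<open>
  The Vandermonde convolution turns the coefficients of \<open>T S\<^sup>*\<close> into the residues of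
  \<open>\<partial>\<^sub>x\<^sup>i (\<Psi>(x,z) \<Psi>\<^sup>*(y,z))\<close> on the diagonal, so neither the antiautomorphism property nor the
  involutivity of the adjoint is needed.
\<close>
lemma left_inverse_adjoint_residue:
  assumes I: "open I" "y \<in> I" and S: "order_le I 0 S" "inf_diff_pdo I S" and T: "order_le I 0 T"
  shows "pdo_mult T (pdo_adjoint S) (- int (Suc i)) y = (-1) ^ Suc i *
     (\<Sum>l\<le>i. of_nat (i choose l) * (\<Sum>p\<le>Suc i. (-1) ^ p * T (- int p) y * (D1 ^^ l) (S (int l + int p - int (Suc i))) y))"
proof -
  let ?e = "Suc i"
  let ?g = "\<lambda>p r. (of_int (- int p) gchoose r :: complex)"
  let ?G = "\<lambda>p l s. T (- int p) y * ((-1) ^ s * (D1 ^^ l) (S (- int s)) y)"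
  have DA: "(D1 ^^ r) (pdo_adjoint S (- int q)) y =
     (\<Sum>s\<le>q. (-1) ^ s * ?g s (q - s) * (D1 ^^ (r + (q - s))) (S (- int s)) y)" for r q
  proof -
    have "(D1 ^^ r) (pdo_adjoint S (- int q)) y =
       (D1 ^^ r) (\<lambda>x. \<Sum>s\<le>q. ((-1) ^ s * ?g s (q - s)) * (D1 ^^ (q - s)) (S (- int s)) x) y"
      using pdo_adjoint_eq[OF I(1) S(1)] by (intro D1_funpow_cong[OF I(1) _ I(2)])
    also have "\<dots> = (\<Sum>s\<le>q. (D1 ^^ r) (\<lambda>x. ((-1) ^ s * ?g s (q - s)) * (D1 ^^ (q - s)) (S (- int s)) x) y)"
      using S(2) by (intro D1_funpow_sum[OF I(1) _ I(2)] inf_diff_on_mult[OF I(1) inf_diff_on_const])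
         (auto simp: inf_diff_pdo_def intro!: inf_diff_on_D1_funpow)
    also have "\<dots> = (\<Sum>s\<le>q. ((-1) ^ s * ?g s (q - s)) * (D1 ^^ r) ((D1 ^^ (q - s)) (S (- int s))) y)"
      using S(2) by (intro sum.cong refl D1_funpow_cmult[OF I(1) _ I(2)])
         (auto simp: inf_diff_pdo_def intro!: inf_diff_on_D1_funpow)
    finally show ?thesis by (simp add: D1_funpow_funpow)
  qed
  have "pdo_mult T (pdo_adjoint S) (- int ?e) y =
     (\<Sum>(p, r, q)\<in>triples ?e. ?g p r * T (- int p) y * (D1 ^^ r) (pdo_adjoint S (- int q)) y)"
    using pdo_mult_graded[OF I T order_le_adjoint[OF I(1) S(1)], of ?e] by simp
  also have "\<dots> = (\<Sum>(p, r, q)\<in>triples ?e. \<Sum>s\<le>q. ?g p r * ?g s (q - s) * ?G p (r + (q - s)) s)"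
    unfolding DA by (simp add: sum_distrib_left mult_ac)
  also have "\<dots> = (\<Sum>((p, r, q), s)\<in>Sigma (triples ?e) (\<lambda>(p, r, q). {..q}). ?g p r * ?g s (q - s) * ?G p (r + (q - s)) s)"
    by (subst sum.Sigma[symmetric]) (auto simp: case_prod_unfold)
  \<comment> \<open>Here l = r + (q - s) collects all derivatives that fall on the coefficient of
    S.\<close>
  also have "\<dots> = (\<Sum>((p, l, s), r)\<in>Sigma (triples ?e) (\<lambda>(p, l, s). {..l}). ?g p r * ?g s (l - r) * ?G p l s)"
    by (rule sum.reindex_bij_witness[of _ "\<lambda>((p, l, s), r). ((p, r, l - r + s), s)"
        "\<lambda>((p, r, q), s). ((p, r + (q - s), s), r)"]) (auto simp: triples_def)
  also have "\<dots> = (\<Sum>(p, l, s)\<in>triples ?e. \<Sum>r\<le>l. ?g p r * ?g s (l - r) * ?G p l s)"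
    by (subst sum.Sigma[symmetric]) (auto simp: case_prod_unfold)
  also have "\<dots> = (\<Sum>(p, l, s)\<in>triples ?e. (-1) ^ ?e * (of_nat (i choose l) * ((-1) ^ p * T (- int p) y * (D1 ^^ l) (S (int l + int p - int ?e)) y)))"
  proof (rule sum.cong[OF refl])
    fix z assume "z \<in> triples ?e"
    then obtain p l s where z: "z = (p, l, s)" and e: "p + l + s = ?e" by (auto simp: triples_def)
    \<comment> \<open>Vandermonde gives -p - s over l; negating the upper index and using p + l + s
      = i + 1 turns this into a signed i over l.\<close>
    have "(\<Sum>r\<le>l. ?g p r * ?g s (l - r)) = (of_int (- int p) + of_int (- int s)) gchoose l"
      by (rule gbinomial_Vandermonde[unfolded atLeast0AtMost])
    also have "\<dots> = (-1) ^ l * ((of_nat l - (of_int (- int p) + of_int (- int s)) - 1) gchoose l)"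
      by (rule gbinomial_negated_upper)
    also have "of_nat l - (of_int (- int p) + of_int (- int s)) - 1 = (of_nat i :: complex)"
    proof -
      have "(of_nat (p + l + s) :: complex) = of_nat ?e" by (simp only: e)
      then show ?thesis by (simp add: algebra_simps)
    qed
    finally have V: "(\<Sum>r\<le>l. ?g p r * ?g s (l - r)) = (-1) ^ l * of_nat (i choose l)"
      by (simp add: binomial_gbinomial)
    have sgn: "(-1) ^ l * (-1) ^ s = (-1 :: complex) ^ ?e * (-1) ^ p"
    proof -
      have "(-1 :: complex) ^ ?e * (-1) ^ p = (-1) ^ (p + p + (l + s))"
        unfolding e[symmetric] by (simp only: power_add[symmetric] ac_simps)
      then show ?thesis by (simp add: power_add)
    qed
    have i: "int l + int p - int ?e = - int s" using e by linarith
    have "(\<Sum>r\<le>l. ?g p r * ?g s (l - r) * ?G p l s) = ((-1) ^ l * (-1) ^ s) * (of_nat (i choose l) * (T (- int p) y * (D1 ^^ l) (S (- int s)) y))"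
      unfolding sum_distrib_right[symmetric] V by (simp only: mult_ac)
    then show "(case z of (p, l, s) \<Rightarrow> \<Sum>r\<le>l. ?g p r * ?g s (l - r) * ?G p l s) =
      (case z of (p, l, s) \<Rightarrow> (-1) ^ ?e * (of_nat (i choose l) * ((-1) ^ p * T (- int p) y * (D1 ^^ l) (S (int l + int p - int ?e)) y)))"
      unfolding z prod.case i sgn by (simp only: mult_ac)
  qed
  also have "\<dots> = (-1) ^ ?e * (\<Sum>(p, l, s)\<in>triples ?e. of_nat (i choose l) * ((-1) ^ p * T (- int p) y * (D1 ^^ l) (S (int l + int p - int ?e)) y))"
    by (simp only: sum_distrib_left case_prod_unfold)
  also have "(\<Sum>(p, l, s)\<in>triples ?e. of_nat (i choose l) * ((-1) ^ p * T (- int p) y * (D1 ^^ l) (S (int l + int p - int ?e)) y))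
     = (\<Sum>(l, p)\<in>{(l, p). l + p \<le> ?e}. of_nat (i choose l) * ((-1) ^ p * T (- int p) y * (D1 ^^ l) (S (int l + int p - int ?e)) y))"
    by (rule sum.reindex_bij_witness[of _ "\<lambda>(l, p). (p, l, ?e - l - p)" "\<lambda>(p, l, s). (l, p)"]) (auto simp: triples_def)
  \<comment> \<open>Terms with l + p > i + 1 vanish because S has order 0, and the term l = i + 1
    because its binomial is 0; so the triangle may be replaced by a rectangle.\<close>
  also have "\<dots> = (\<Sum>(l, p)\<in>{..i} \<times> {..?e}. of_nat (i choose l) * ((-1) ^ p * T (- int p) y * (D1 ^^ l) (S (int l + int p - int ?e)) y))"
  proof (rule sum.mono_neutral_cong)
    show "finite {(l, p). l + p \<le> ?e}"
      by (rule finite_subset[of _ "{..?e} \<times> {..?e}"]) auto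
    fix z assume z: "z \<in> {..i} \<times> {..?e} - {(l, p). l + p \<le> ?e}"
    then obtain l p where zz: "z = (l, p)" "l + p > ?e" by (cases z) auto
    then have "(D1 ^^ l) (S (int l + int p - int ?e)) y = 0"
      by (intro D1_funpow_eq_zero[OF I(1) order_leD[OF S(1)] I(2)]) auto
    then show "(case z of (l, p) \<Rightarrow> of_nat (i choose l) * ((-1) ^ p * T (- int p) y * (D1 ^^ l) (S (int l + int p - int ?e)) y)) = 0"
      unfolding zz(1) by simp
  next
    fix z assume z: "z \<in> {(l, p). l + p \<le> ?e} - {..i} \<times> {..?e}"
    then obtain l p where zz: "z = (l, p)" "l > i" by (cases z) auto
    then show "(case z of (l, p) \<Rightarrow> of_nat (i choose l) * ((-1) ^ p * T (- int p) y * (D1 ^^ l) (S (int l + int p - int ?e)) y)) = 0"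
      by simp
  qed auto
  finally show ?thesis by (simp only: sum.cartesian_product[symmetric] sum_distrib_left)
qed

section \<open>Operators P with \<open>L P = P \<partial>^N\<close> and their constants of
  integration\<close>

lemma pdo_dx_funpow_lincomb:
  assumes "open J" "\<And>p. p \<in> A \<Longrightarrow> inf_diff_pdo J (P p)" "x \<in> J"
  shows "(pdo_dx ^^ i) (\<lambda>m x. \<Sum>p\<in>A. t p * P p m x) n x = (\<Sum>p\<in>A. t p * (pdo_dx ^^ i) (P p) n x)"
proof -
  have sm: "inf_diff_on J (P p m)" if "p \<in> A" for p m using assms(2)[OF that] by (simp add: inf_diff_pdo_def)
  have "(D1 ^^ l) (\<lambda>x. \<Sum>p\<in>A. t p * P p m x) x = (\<Sum>p\<in>A. t p * (D1 ^^ l) (P p m) x)" for l m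
    using sm by (subst D1_funpow_sum[OF assms(1) _ assms(3)])
      (auto intro!: inf_diff_on_mult[OF assms(1)] sum.cong D1_funpow_cmult[OF assms(1) _ assms(3)])
  moreover have "inf_diff_pdo J (\<lambda>m x. \<Sum>p\<in>A. t p * P p m x)"
    using sm by (auto simp: inf_diff_pdo_def intro!: inf_diff_on_sum inf_diff_on_mult assms(1))
  ultimately have "(pdo_dx ^^ i) (\<lambda>m x. \<Sum>p\<in>A. t p * P p m x) n x
      = (\<Sum>l\<le>i. \<Sum>p\<in>A. t p * (of_nat (i choose l) * (D1 ^^ l) (P p (n - int i + int l)) x))"
    by (simp add: pdo_dx_funpow[OF assms(1) _ assms(3)] sum_distrib_left mult_ac)
  also have "\<dots> = (\<Sum>p\<in>A. t p * (pdo_dx ^^ i) (P p) n x)"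
    by (subst sum.swap) (simp add: pdo_dx_funpow[OF assms(1) assms(2) assms(3)] sum_distrib_left)
  finally show ?thesis .
qed

lemma L_act_lincomb:
  assumes "open J" "\<And>p. p \<in> A \<Longrightarrow> inf_diff_pdo J (P p)" "x \<in> J"
  shows "L_act N u (\<lambda>m x. \<Sum>p\<in>A. t p * P p m x) n x = (\<Sum>p\<in>A. t p * L_act N u (P p) n x)"
proof -
  have "(\<Sum>i\<le>N - 2. u i x * (\<Sum>p\<in>A. t p * (pdo_dx ^^ i) (P p) n x))
      = (\<Sum>p\<in>A. t p * (\<Sum>i\<le>N - 2. u i x * (pdo_dx ^^ i) (P p) n x))"
    unfolding sum_distrib_left by (subst sum.swap) (simp add: mult_ac)
  moreover have "(pdo_dx ^^ i) (\<lambda>m x. \<Sum>p\<in>A. t p * P p m x) n x = (\<Sum>p\<in>A. t p * (pdo_dx ^^ i) (P p) n x)" for i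
    by (rule pdo_dx_funpow_lincomb[OF assms])
  ultimately show ?thesis
    unfolding L_act_def by (simp only: sum.distrib distrib_left)
qed

text \<open>Shifting the order is right composition with a power of \<partial>, which commutes with
  left composition.\<close>

lemma pdo_dx_funpow_shift: "(pdo_dx ^^ i) (\<lambda>m. P (m + k)) n x = (pdo_dx ^^ i) P (n + k) x"
proof (induction i arbitrary: n x)
  case (Suc i)
  have "(pdo_dx ^^ i) (\<lambda>m. P (m + k)) n = (pdo_dx ^^ i) P (n + k)" for n
    using Suc.IH by (intro ext)
  then show ?case by (simp add: pdo_dx_def[of "(pdo_dx ^^ i) _"] algebra_simps)
qed simp

lemma L_act_shift: "L_act N u (\<lambda>m. P (m + k)) n x = L_act N u P (n + k) x"
  by (simp add: L_act_def pdo_dx_funpow_shift)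

text \<open>Descending induction on the order. If all coefficients above q vanish, the equation
  makes \<open>P q\<close> constant on the interval, and the residue of a suitable
  \<open>\<partial>^k P\<close> at y is the value of that constant.\<close>

lemma intertwiner_eq_0:
  assumes "N \<ge> 2" "open J" "is_interval J" "y \<in> J" "inf_diff_pdo J P"
    and L: "\<And>n x. x \<in> J \<Longrightarrow> L_act N u P n x = P (n - int N) x"
    and res: "\<And>i. (pdo_dx ^^ i) P (- 1) y = 0"
    and top: "\<And>m x. m \<ge> 0 \<Longrightarrow> x \<in> J \<Longrightarrow> P m x = 0"
    and "x \<in> J"
  shows "P n x = 0"
proof -
  have "\<forall>m\<ge>- int k. \<forall>x\<in>J. P m x = 0" for k
  proof (induction k)
    case 0
    then show ?case using top by simp
  next
    case (Suc k)
    define q where "q = - int (Suc k)"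
    have D0: "(D1 ^^ l) (P m) x = 0" if "m > q" "x \<in> J" for l m x
      using that Suc.IH by (intro D1_funpow_eq_zero[OF assms(2)]) (auto simp: q_def)
    have der: "D1 (P q) x = 0" if x: "x \<in> J" for x
    proof -
      \<comment> \<open>At this order \<open>\<partial>^N P\<close> contains N times the derivative
        of \<open>P q\<close>; its other term \<open>P (q - 1)\<close> cancels against
        \<open>P \<partial>^N\<close>, and the lower powers of \<partial> in L contribute only
        coefficients above q.\<close>
      let ?n = "q + int N - 1"
      have "(pdo_dx ^^ i) P ?n x = 0" if "i \<le> N - 2" for i
        unfolding pdo_dx_funpow[OF assms(2,5) x] using that assms(1) x by (simp add: D0)
      then have "L_act N u P ?n x = (pdo_dx ^^ N) P ?n x" by (simp add: L_act_def)
      also have "\<dots> = (\<Sum>l\<in>{0, 1}. of_nat (N choose l) * (D1 ^^ l) (P (?n - int N + int l)) x)"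
        unfolding pdo_dx_funpow[OF assms(2,5) x]
        by (rule sum.mono_neutral_right) (use assms(1) x in \<open>auto intro!: D0\<close>)
      also have "\<dots> = P (?n - int N) x + of_nat N * D1 (P q) x" by simp
      finally show ?thesis using L[OF x, of ?n] assms(1) by simp
    qed
    \<comment> \<open>Since q = -1 - k, only l = 0 is left of this residue, and it is
      \<open>P q y\<close>.\<close>
    have "(pdo_dx ^^ k) P (- 1) y = (\<Sum>l\<in>{0}. of_nat (k choose l) * (D1 ^^ l) (P (- 1 - int k + int l)) y)"
      unfolding pdo_dx_funpow[OF assms(2,5,4)]
      by (rule sum.mono_neutral_right) (use assms(4) in \<open>auto intro!: D0 simp: q_def\<close>)
    then have Py: "P q y = 0" using res[of k] by (simp add: q_def algebra_simps)
    have "(P q has_vector_derivative 0) (at x within J)" if "x \<in> J" for x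
      using has_vector_derivative_D1[OF inf_diff_on_differentiable[OF _ that, of "P q"]] assms(5) der[OF that]
      by (auto simp: inf_diff_pdo_def intro: has_vector_derivative_at_within)
    then obtain c where "\<And>x. x \<in> J \<Longrightarrow> P q x = c"
      using has_vector_derivative_zero_constant[of J "P q"] is_interval_convex[OF assms(3)] by blast
    then have "P q x = 0" if "x \<in> J" for x using Py assms(4) that by metis
    moreover have "m \<ge> - int k \<or> m = q" if "m \<ge> - int (Suc k)" for m
      using that by (simp add: q_def) linarith
    ultimately show ?case using Suc.IH by blast
  qed
  from this[of "nat (- n)"] show ?thesis using assms(9) by auto
qed

text \<open>With \<open>t_p = (-1)^p T_(-p)(y)\<close>, constant in x, W is the sum of the operators
  \<open>t_p S \<partial>^(-p)\<close>. So the relation \<open>L S = S \<partial>^N\<close> passes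
  from S to W, and the residues at y are up to sign coefficients of negative order in the product of
  T with the adjoint of S, which is 1.\<close>

lemma wave_function_product:
  assumes "N \<ge> 2" "open I" "wave_operator_on I N u S" "pdo_inverse_on I (pdo_adjoint S) T" "y \<in> I"
  defines "W \<equiv> pdo_series (\<lambda>n x. omega S T n x y)"
  shows "inf_diff_pdo I W"
    and "\<And>n x. x \<in> I \<Longrightarrow> L_act N u W n x = W (n - int N) x"
    and "\<And>i. (pdo_dx ^^ i) W (- 1) y = 0"
    and "\<And>m x. m > 0 \<Longrightarrow> W m x = 0"
    and "\<And>x. x \<in> I \<Longrightarrow> W 0 x = 1"
proof -
  have S: "pdo_on I S" "order_le I 0 S" "\<And>x. x \<in> I \<Longrightarrow> S 0 x = 1"
    using assms(3) by (auto simp: wave_operator_on_def order_le_def)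
  note Ssm = pdo_onD(1)[OF assms(2) S(1)]
  have T: "pdo_on I T" and TS: "pdo_eq_on I (pdo_mult T (pdo_adjoint S)) (pdo_pow_dx 0)"
    using assms(4) by (auto simp: pdo_inverse_on_def)
  obtain M where "order_le I M T" using pdo_onD(2)[OF assms(2) T] ..
  then have M: "order_le I (int (nat M)) T" by (auto simp: order_le_def)
  have A0: "pdo_adjoint S 0 x = 1" if "x \<in> I" for x
    using pdo_adjoint_eq[OF assms(2) S(2) that, of 0] S(3)[OF that] by simp
  have T0: "order_le I 0 T" "T 0 y = 1"
    using order_le_0_of_left_inverse[OF assms(2) M order_le_adjoint[OF assms(2) S(2)] _ TS] A0 assms(5)
    by auto
  define t where "t p = (-1) ^ p * T (- int p) y" for p :: nat
  have pm: "(-1 :: complex) powi (- int s) = (-1) ^ s" for s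
    by (simp add: power_int_minus power_inverse[symmetric])
  \<comment> \<open>The cutoff K may be any number at least -m: beyond -m the index of S is positive
    and its coefficient 0.\<close>
  have W: "W m x = (\<Sum>p\<le>K. t p * S (m + int p) x)" if "x \<in> I" "- int K \<le> m" for m x K
  proof (cases "m \<le> 0")
    case True
    define e where "e = nat (- m)"
    have m: "m = - int e" using True by (simp add: e_def)
    have "W m x = (\<Sum>k\<le>e. S (- int k) x * t (e - k))"
      unfolding W_def pdo_series_def omega_def exp_symbol_def t_def pm m
      by (intro if_P[THEN trans] sum.cong) (simp_all only: pm, simp_all)
    also have "\<dots> = (\<Sum>p\<le>e. t p * S (m + int p) x)"
      by (rule sum.reindex_bij_witness[of _ "\<lambda>p. e - p" "\<lambda>k. e - k"]) (auto simp: m of_nat_diff)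
    also have "\<dots> = (\<Sum>p\<le>K. t p * S (m + int p) x)"
      using that by (intro sum.mono_neutral_left) (auto simp: m intro!: order_leD[OF S(2)])
    finally show ?thesis .
  next
    case False
    then show ?thesis using order_leD[OF S(2) _ that(1)] by (simp add: W_def pdo_series_def)
  qed
  have sh: "inf_diff_pdo I (\<lambda>m. S (m + int p))" for p using Ssm by (simp add: inf_diff_pdo_def)
  show "inf_diff_pdo I W"
    unfolding inf_diff_pdo_def
  proof
    fix m
    have "inf_diff_on I (\<lambda>x. \<Sum>p\<le>nat (- m). t p * S (m + int p) x)"
      using Ssm by (auto simp: inf_diff_pdo_def intro!: inf_diff_on_sum inf_diff_on_mult assms(2))
    then show "inf_diff_on I (W m)"
      by (subst inf_diff_on_cong[OF assms(2) W[of _ "nat (- m)"]]) auto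
  qed
  show "L_act N u W n x = W (n - int N) x" if x: "x \<in> I" for n x
  proof -
    \<comment> \<open>L looks N orders down from n, so the cutoff has to cover order n - N.\<close>
    let ?K = "nat (int N - n)"
    have "L_act N u W n x = L_act N u (\<lambda>m x. \<Sum>p\<le>?K. t p * S (m + int p) x) n x"
      by (rule L_act_cong[OF assms(2) _ x]) (rule W, auto)
    also have "\<dots> = (\<Sum>p\<le>?K. t p * S (n + int p - int N) x)"
      by (simp add: L_act_lincomb[OF assms(2) sh x] L_act_shift wave_operator_L_act[OF assms(1-3) x])
    also have "\<dots> = W (n - int N) x"
      by (subst W[OF x, of ?K]) (auto simp: algebra_simps)
    finally show ?thesis .
  qed
  show "(pdo_dx ^^ i) W (- 1) y = 0" for i
  proof -
    \<comment> \<open>Starting from order -1, i steps reach order -(i + 1), hence the cutoff Suc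
      i.\<close>
    have "(pdo_dx ^^ i) W (- 1) y = (pdo_dx ^^ i) (\<lambda>m x. \<Sum>p\<le>Suc i. t p * S (m + int p) x) (- 1) y"
      by (rule pdo_dx_funpow_cong[OF assms(2) _ assms(5)]) (rule W, auto)
    also have "\<dots> = (\<Sum>p\<le>Suc i. t p * (\<Sum>l\<le>i. of_nat (i choose l) * (D1 ^^ l) (S (int l + int p - int (Suc i))) y))"
      unfolding pdo_dx_funpow_lincomb[OF assms(2) sh assms(5)] pdo_dx_funpow[OF assms(2) sh assms(5)]
      by (simp add: algebra_simps)
    also have "\<dots> = (\<Sum>l\<le>i. of_nat (i choose l) * (\<Sum>p\<le>Suc i. (-1) ^ p * T (- int p) y * (D1 ^^ l) (S (int l + int p - int (Suc i))) y))"
      unfolding sum_distrib_left t_def by (subst sum.swap) (simp add: mult_ac)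
    also have "\<dots> = (-1) ^ Suc i * pdo_mult T (pdo_adjoint S) (- int (Suc i)) y"
    proof -
      have "(-1) ^ Suc i * ((-1) ^ Suc i * z) = z" for z :: complex
        by (simp add: mult.assoc[symmetric])
      then show ?thesis
        by (simp only: left_inverse_adjoint_residue[OF assms(2,5) S(2) Ssm T0(1), of i])
    qed
    also have "\<dots> = 0" using TS assms(5) by (simp add: pdo_eq_on_def pdo_pow_dx_def)
    finally show ?thesis .
  qed
  show "W m x = 0" if "m > 0" for m x using that by (simp add: W_def pdo_series_def)
  show "W 0 x = 1" if "x \<in> I" for x
    using W[OF that, of 0 0] S(3)[OF that] T0(2) by (simp add: t_def)
qed

section \<open>Heat kernel expansions as pseudo-differential operators\<close>

lemma sum_rotate:
  "(\<Sum>s\<in>A. \<Sum>i\<in>B. \<Sum>p\<in>C. f s i p) = (\<Sum>i\<in>B. \<Sum>p\<in>C. \<Sum>s\<in>A. f s i p)"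
  by (subst sum.swap) (intro sum.cong refl sum.swap)

text \<open>Transfers the elimination in \<open>hk_reduce\<close> to operators. The shift by K makes
  every exponent s with a nonzero coefficient at least R, so up to R reductions are possible; Q is
  large enough for reindexing by p to lose no nonzero term.\<close>

lemma airy_op_reduce_sum:
  fixes X :: "nat \<Rightarrow> int \<Rightarrow> complex"
  assumes N: "N \<ge> 2" "c = \<kappa> / of_nat N" and X: "\<And>i k. k < - int b \<Longrightarrow> X i k = 0"
    and K: "R + b \<le> K" "R \<le> Q"
    and van: "\<And>j s. j \<le> N - 2 \<Longrightarrow> s > Q - R \<Longrightarrow> airy_op N c d j s n = 0"
  shows "(\<Sum>i\<le>R. \<Sum>s\<le>Q. X i (int s - int K) * airy_op N c d i s n) =
    (\<Sum>j\<le>N - 2. \<Sum>s\<le>Q. (\<Sum>i\<le>R. \<Sum>p\<le>R. X i (int s - int K + int p) * airy_coeff N \<kappa> d p i j)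
       * airy_op N c d j s n)"
proof -
  let ?g = "\<lambda>i p j s. X i (int s - int K) * airy_coeff N \<kappa> d p i j * airy_op N c d j (s - p) n"
  let ?h = "\<lambda>i p j s. X i (int s - int K + int p) * airy_coeff N \<kappa> d p i j * airy_op N c d j s n"
  have X0: "X i (int s - int K) = 0" if "s < R" for i s
    using that K by (intro X) auto
  have "(\<Sum>i\<le>R. \<Sum>s\<le>Q. X i (int s - int K) * airy_op N c d i s n) = (\<Sum>i\<le>R. \<Sum>s\<le>Q. \<Sum>p\<le>R. \<Sum>j\<le>N - 2. ?g i p j s)"
  proof (intro sum.cong refl)
    fix i s assume i: "i \<in> {..R}"
    show "X i (int s - int K) * airy_op N c d i s n = (\<Sum>p\<le>R. \<Sum>j\<le>N - 2. ?g i p j s)"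
    proof (cases "s < R")
      case False
      then show ?thesis
        using airy_op_reduce[OF N, of i R s d n] i by (simp add: sum_distrib_left mult.assoc)
    qed (simp add: X0)
  qed
  also have "\<dots> = (\<Sum>i\<le>R. \<Sum>p\<le>R. \<Sum>j\<le>N - 2. \<Sum>s\<le>Q. ?g i p j s)"
    by (intro sum.cong refl sum_rotate)
  also have "\<dots> = (\<Sum>i\<le>R. \<Sum>p\<le>R. \<Sum>j\<le>N - 2. \<Sum>s\<le>Q. ?h i p j s)"
  proof (rule sum.cong[OF refl], rule sum.cong[OF refl], rule sum.cong[OF refl])
    fix i p j assume p: "p \<in> {..R}" and j: "j \<in> {..N - 2}"
    \<comment> \<open>Exponents below p drop out because X vanishes there; after the shift the range
      is refilled up to Q with vanishing operator coefficients.\<close>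
    have "(\<Sum>s\<le>Q. ?g i p j s) = (\<Sum>s\<in>{p..Q}. ?g i p j s)"
      using p by (intro sum.mono_neutral_right) (auto simp: X0)
    also have "\<dots> = (\<Sum>s\<le>Q - p. ?h i p j s)"
      using p K(2) by (intro sum.reindex_bij_witness[of _ "\<lambda>s. s + p" "\<lambda>s. s - p"]) (auto simp: of_nat_diff)
    also have "\<dots> = (\<Sum>s\<le>Q. ?h i p j s)"
      using p j by (intro sum.mono_neutral_left) (auto simp: van)
    finally show "(\<Sum>s\<le>Q. ?g i p j s) = (\<Sum>s\<le>Q. ?h i p j s)" .
  qed
  also have "\<dots> = (\<Sum>j\<le>N - 2. \<Sum>i\<le>R. \<Sum>p\<le>R. \<Sum>s\<le>Q. ?h i p j s)"
    by (rule sum_rotate[symmetric])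
  also have "\<dots> = (\<Sum>j\<le>N - 2. \<Sum>s\<le>Q. \<Sum>i\<le>R. \<Sum>p\<le>R. ?h i p j s)"
    by (intro sum.cong refl sum_rotate[symmetric])
  finally show ?thesis by (simp add: sum_distrib_right)
qed

text \<open>Each use of the Airy equation lowers the index by at least N - 1 \<ge> 1, so at most i
  uses are possible.\<close>

lemma airy_coeff_eq_0: "N \<ge> 2 \<Longrightarrow> i < p \<Longrightarrow> airy_coeff N \<kappa> d p i j = 0"
  by (induction p arbitrary: i) auto

lemma hk_reduce_eq:
  assumes "N \<ge> 2" "\<And>i k. i > R \<Longrightarrow> F i k x y = 0"
  shows "hk_reduce N \<kappa> F j k x y =
    (\<Sum>i\<le>R. \<Sum>p\<le>R. F i (k + int p) x y * airy_coeff N \<kappa> (of_real (x - y)) p i j)"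
proof -
  let ?f = "\<lambda>(i, p). F i (k + int p) x y * airy_coeff N \<kappa> (of_real (x - y)) p i j"
  have z: "?f ip = 0" if "ip \<notin> {..R} \<times> {..R}" for ip
  proof -
    obtain i p where ip: "ip = (i, p)" by (cases ip)
    show ?thesis using that assms(2)[of i] airy_coeff_eq_0[OF assms(1), of i p]
      by (cases "i > R") (auto simp: ip)
  qed
  have "{ip. ?f ip \<noteq> 0} \<subseteq> {..R} \<times> {..R}" using z by blast
  then have "hk_reduce N \<kappa> F j k x y = sum ?f ({..R} \<times> {..R})"
    unfolding hk_reduce_def by (intro Sum_any.expand_superset) simp
  then show ?thesis by (simp only: sum.cartesian_product)
qed

text \<open>Image of F under \<open>t^k a_j \<mapsto> c^k \<partial>^j D_N^k\<close>, cut off at j =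
  R and k = Q; terms with negative k are left out.\<close>

definition airy_sum :: "nat \<Rightarrow> complex \<Rightarrow> nat \<Rightarrow> nat \<Rightarrow> expansion \<Rightarrow> real \<Rightarrow> pdo" where
  "airy_sum N c R Q F y = (\<lambda>n x. \<Sum>j\<le>R. \<Sum>k\<le>Q. F j (int k) x y * airy_op N c (of_real (x - y)) j k n)"

lemma sum_pred_shift:
  fixes f g :: "nat \<Rightarrow> complex"
  assumes "f R = 0"
  shows "(\<Sum>j\<le>R. (if j = 0 then 0 else f (j - 1)) * g j) = (\<Sum>j\<le>R. f j * g (Suc j))"
proof (cases R)
  case (Suc r)
  show ?thesis unfolding Suc using assms Suc by (subst sum.atMost_Suc_shift) simp
qed (use assms in simp)

lemma inf_diff_pdo_airy_sum:
  assumes "open J" "\<And>j k. inf_diff_on J (\<lambda>x. F j k x y)"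
  shows "inf_diff_pdo J (airy_sum N c R Q F y)"
  using assms inf_diff_on_subset[OF conjunct1[OF airy_op_dx]]
  by (auto simp: inf_diff_pdo_def airy_sum_def simp del: of_real_diff intro!: inf_diff_on_sum inf_diff_on_mult)

text \<open>By the product rule and \<open>airy_op_dx\<close>, \<open>hk_dx\<close> becomes left
  composition with \<partial>. The entry j = R has to vanish because its image would have index R +
  1, outside the cutoff.\<close>

lemma pdo_dx_airy_sum:
  assumes J: "open J" "x \<in> J" and F: "\<And>j k. inf_diff_on J (\<lambda>x. F j k x y)" and R: "\<And>k. F R k x y = 0"
  shows "pdo_dx (airy_sum N c R Q F y) n x = airy_sum N c R Q (hk_dx F) y n x"
proof -
  let ?b = "\<lambda>j k n x. airy_op N c (of_real (x - y)) j k n"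
  have b: "inf_diff_on J (?b j k n)" for j k n
    using inf_diff_on_subset[OF conjunct1[OF airy_op_dx]] by blast
  have Fb: "inf_diff_on J (\<lambda>x. F j k x y * ?b j' k' n x)" for j k j' k' n
    by (intro inf_diff_on_mult J F b)
  have "D1 (airy_sum N c R Q F y n) x = (\<Sum>j\<le>R. \<Sum>k\<le>Q. D1 (\<lambda>x. F j (int k) x y * ?b j k n x) x)"
    unfolding airy_sum_def
    by (subst D1_sum[OF J(1) _ J(2)], intro inf_diff_on_sum J Fb)
       (intro sum.cong refl D1_sum[OF J(1) _ J(2)] Fb)
  also have "\<dots> = (\<Sum>j\<le>R. \<Sum>k\<le>Q. D1 (\<lambda>x. F j (int k) x y) x * ?b j k n x + F j (int k) x y * D1 (?b j k n) x)"
    by (intro sum.cong refl D1_mult inf_diff_on_differentiable[OF _ J(2)] F b)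
  finally have "pdo_dx (airy_sum N c R Q F y) n x = (\<Sum>j\<le>R. \<Sum>k\<le>Q. D1 (\<lambda>x. F j (int k) x y) x * ?b j k n x
      + F j (int k) x y * (D1 (?b j k n) x + ?b j k (n - 1) x))"
    unfolding pdo_dx_def by (simp add: airy_sum_def sum.distrib[symmetric] algebra_simps del: of_real_diff)
  also have "\<dots> = (\<Sum>j\<le>R. \<Sum>k\<le>Q. D1 (\<lambda>x. F j (int k) x y) x * ?b j k n x)
      + (\<Sum>k\<le>Q. \<Sum>j\<le>R. F j (int k) x y * ?b (Suc j) k n x)"
    unfolding conjunct2[OF airy_op_dx] sum.distrib by (subst (3) sum.swap) (rule refl)
  also have "(\<Sum>k\<le>Q. \<Sum>j\<le>R. F j (int k) x y * ?b (Suc j) k n x)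
      = (\<Sum>j\<le>R. \<Sum>k\<le>Q. (if j = 0 then 0 else F (j - 1) (int k) x y) * ?b j k n x)"
    by (subst sum.swap) (intro sum.cong refl sum_pred_shift[where f = "\<lambda>j. F j (int k) x y" for k, symmetric] R)
  finally show ?thesis
    by (simp add: airy_sum_def hk_dx_def sum.distrib[symmetric] distrib_right del: of_real_diff)
qed

lemma inf_diff_on_hk_dx_funpow:
  assumes "open J" "\<And>j k. inf_diff_on J (\<lambda>x. F j k x y)"
  shows "inf_diff_on J (\<lambda>x. (hk_dx ^^ i) F j k x y)"
  using assms(2)
proof (induction i arbitrary: j k)
  case (Suc i)
  have "inf_diff_on J (\<lambda>x. D1 (\<lambda>s. (hk_dx ^^ i) F j k s y) x)"
    using inf_diff_on_D1[OF Suc.IH[OF Suc.prems]] by simp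
  moreover have "inf_diff_on J (\<lambda>x. if j = 0 then 0 else (hk_dx ^^ i) F (j - 1) k x y)"
    using Suc.IH[OF Suc.prems] by (cases "j = 0") auto
  ultimately show ?case
    by (simp add: hk_dx_def[of "(hk_dx ^^ i) F"] inf_diff_on_add[OF assms(1)])
qed simp

lemma hk_dx_funpow_eq_0:
  assumes "\<And>j k x. j > r \<Longrightarrow> F j k x y = 0" "j > r + i"
  shows "(hk_dx ^^ i) F j k x y = 0"
  using assms(2)
proof (induction i arbitrary: j x)
  case (Suc i)
  then have "(\<lambda>s. (hk_dx ^^ i) F j k s y) = (\<lambda>s. 0)" "(hk_dx ^^ i) F (j - 1) k x y = 0" by auto
  then show ?case by (simp add: hk_dx_def[of "(hk_dx ^^ i) F"])
qed (use assms(1) in simp)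

lemma hk_dx_funpow_eq_0':
  assumes "\<And>j x. F j k x y = 0"
  shows "(hk_dx ^^ i) F j k x y = 0"
proof (induction i arbitrary: j x)
  case (Suc i)
  then show ?case by (simp add: hk_dx_def[of "(hk_dx ^^ i) F"])
qed (use assms in simp)

text \<open>Each differentiation raises the largest index j by at most one, so r + i \<le> R keeps
  every intermediate expansion inside the cutoff.\<close>

lemma pdo_dx_funpow_airy_sum:
  assumes J: "open J" and F: "\<And>j k. inf_diff_on J (\<lambda>x. F j k x y)"
    and r: "\<And>j k x. j > r \<Longrightarrow> F j k x y = 0" and "r + i \<le> R" "x \<in> J"
  shows "(pdo_dx ^^ i) (airy_sum N c R Q F y) n x = airy_sum N c R Q ((hk_dx ^^ i) F) y n x"
  using assms(4,5)
proof (induction i arbitrary: n x)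
  case (Suc i)
  have IH: "(pdo_dx ^^ i) (airy_sum N c R Q F y) n x = airy_sum N c R Q ((hk_dx ^^ i) F) y n x" if "x \<in> J" for n x
    using Suc that by simp
  have "(pdo_dx ^^ Suc i) (airy_sum N c R Q F y) n x = pdo_dx (airy_sum N c R Q ((hk_dx ^^ i) F) y) n x"
    using IH differentiable_cong_open(2)[OF J IH Suc.prems(2)] Suc.prems
    by (simp add: pdo_dx_def[of "(pdo_dx ^^ i) _"] pdo_dx_def[of "airy_sum N c R Q ((hk_dx ^^ i) F) y"])
  also have "\<dots> = airy_sum N c R Q (hk_dx ((hk_dx ^^ i) F)) y n x"
    by (rule pdo_dx_airy_sum[where F = "(hk_dx ^^ i) F", OF J Suc.prems(2) inf_diff_on_hk_dx_funpow[where F = F, OF J F]])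
       (rule hk_dx_funpow_eq_0[where F = F and r = r, OF r], use Suc.prems in auto)
  finally show ?case by simp
qed simp

lemma L_act_airy_sum:
  assumes J: "open J" and F: "\<And>j k. inf_diff_on J (\<lambda>x. F j k x y)"
    and r: "\<And>j k x. j > r \<Longrightarrow> F j k x y = 0" and "r + N \<le> R" "x \<in> J"
  shows "L_act N u (airy_sum N c R Q F y) n x = airy_sum N c R Q (hk_L N u F) y n x"
proof -
  have "(pdo_dx ^^ i) (airy_sum N c R Q F y) n x = airy_sum N c R Q ((hk_dx ^^ i) F) y n x" if "i \<le> N" for i
    using assms(4,5) that by (intro pdo_dx_funpow_airy_sum[where F = F, OF J F r]) auto
  then have "L_act N u (airy_sum N c R Q F y) n x = airy_sum N c R Q ((hk_dx ^^ N) F) y n x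
      + (\<Sum>i\<le>N - 2. u i x * airy_sum N c R Q ((hk_dx ^^ i) F) y n x)"
    unfolding L_act_def by simp
  also have "(\<Sum>i\<le>N - 2. u i x * airy_sum N c R Q ((hk_dx ^^ i) F) y n x)
     = (\<Sum>j\<le>R. \<Sum>k\<le>Q. (\<Sum>i\<le>N - 2. u i x * (hk_dx ^^ i) F j (int k) x y) * airy_op N c (of_real (x - y)) j k n)"
    unfolding airy_sum_def sum_distrib_left sum_distrib_right
    by (subst sum_rotate) (simp only: mult.assoc)
  finally show ?thesis
    by (simp add: airy_sum_def hk_L_def sum.distrib[symmetric] distrib_right del: of_real_diff)
qed

section \<open>Right multiplication by \<open>c D_N\<close> on coefficient sequences at a fixed
  point, with d = x - y\<close>

definition airy_right :: "nat \<Rightarrow> complex \<Rightarrow> complex \<Rightarrow> (int \<Rightarrow> complex) \<Rightarrow> int \<Rightarrow> complex" where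
  "airy_right N c d P n = - c * (d * P (n + int N - 1) + of_int (n + 1) * P (n + int N))"

lemma airy_right_funpow_airy_op: "(airy_right N c d ^^ K) (airy_op N c d j k) = airy_op N c d j (k + K)"
  by (induction K) (auto simp: airy_right_def fun_eq_iff)

lemma airy_right_funpow_lincomb:
  "(airy_right N c d ^^ K) (\<lambda>n. \<Sum>a\<in>A. t a * P a n) n = (\<Sum>a\<in>A. t a * (airy_right N c d ^^ K) (P a) n)"
proof (induction K arbitrary: n)
  case (Suc K)
  show ?case
    by (simp add: airy_right_def[of _ _ _ "(airy_right N c d ^^ K) _"] Suc.IH sum_distrib_left sum.distrib[symmetric] algebra_simps
      sum_negf[symmetric])
qed simp

lemma airy_right_funpow_diff:
  "(airy_right N c d ^^ K) (\<lambda>n. P n - P' n) n = (airy_right N c d ^^ K) P n - (airy_right N c d ^^ K) P' n"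
proof (induction K arbitrary: n)
  case (Suc K)
  show ?case
    by (simp add: airy_right_def[of _ _ _ "(airy_right N c d ^^ K) _"] Suc.IH algebra_simps)
qed simp

lemma airy_right_funpow_cong:
  assumes "N \<ge> 1" "\<And>m. m \<ge> n \<Longrightarrow> P m = P' m"
  shows "(airy_right N c d ^^ K) P n = (airy_right N c d ^^ K) P' n"
  using assms(2)
proof (induction K arbitrary: n)
  case (Suc K)
  have "(airy_right N c d ^^ K) P m = (airy_right N c d ^^ K) P' m" if "m \<ge> n" for m
    using that Suc.prems by (intro Suc.IH) auto
  then show ?case using assms(1)
    by (simp add: airy_right_def[of _ _ _ "(airy_right N c d ^^ K) _"])
qed simp

text \<open>For d \<noteq> 0 the leading coefficient -d of \<open>D_N\<close> is invertible, so the
  coefficients of P are recovered one by one from the top.\<close>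

lemma airy_right_eq_0D:
  assumes "c \<noteq> 0" "d \<noteq> 0" "\<And>n. n > b \<Longrightarrow> P n = 0" "\<And>n. airy_right N c d P n = 0"
  shows "P n = 0"
proof -
  have "\<forall>m > b - int k. P m = 0" for k
  proof (induction k)
    case (Suc k)
    have "P (b - int k) = 0"
    proof -
      have "P (b - int k + 1) = 0" using Suc.IH by simp
      then show ?thesis using assms(1,2) assms(4)[of "b - int k - int N + 1"]
        by (simp add: airy_right_def algebra_simps)
    qed
    moreover have "m > b - int k \<or> m = b - int k" if "m > b - int (Suc k)" for m using that by linarith
    ultimately show ?case using Suc.IH by blast
  qed (use assms(3) in simp)
  from this[of "nat (b - n + 1)"] show ?thesis by simp
qed

lemma airy_right_funpow_eq_0D:
  assumes "N \<ge> 1" "c \<noteq> 0" "d \<noteq> 0" "\<And>n. n > b \<Longrightarrow> P n = 0" "\<And>n. (airy_right N c d ^^ K) P n = 0"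
  shows "P n = 0"
  using assms(4,5)
proof (induction K arbitrary: P n)
  case (Suc K)
  have "airy_right N c d P n = 0" for n
  proof (rule Suc.IH)
    show "airy_right N c d P n = 0" if "n > b" for n
      using that assms(1) Suc.prems(1) by (simp add: airy_right_def)
    show "(airy_right N c d ^^ K) (airy_right N c d P) n = 0" for n
      using Suc.prems(2)[of n] by (simp add: funpow_swap1)
  qed
  then show ?case
    by (intro airy_right_eq_0D[where P = P and b = b, OF assms(2,3) Suc.prems(1)])
qed simp

text \<open>Composing with \<open>\<partial>^N\<close> and then with \<open>c D_N\<close> on the
  right corresponds to \<kappa> times t d/dt on \<open>t^k a_j\<close>. Euler's identity supplies
  the factor k - (j + 1)/N, and c N = \<kappa>.\<close>

lemma airy_right_shift_airy_op:
  assumes "N \<ge> 1" "c = \<kappa> / of_nat N"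
  shows "airy_right N c d (\<lambda>m. airy_op N c d j k (m - int N)) n
    = \<kappa> * ((of_nat k - of_nat (j + 1) / of_nat N) * airy_op N c d j k n - d / of_nat N * airy_op N c d (Suc j) k n)"
proof -
  have "airy_right N c d (\<lambda>m. airy_op N c d j k (m - int N)) n
      = c * (d * (airy_op N c d (Suc j) k n - airy_op N c d j k (n - 1)) - d * airy_op N c d (Suc j) k n
          - of_int (n + 1) * airy_op N c d j k n)"
    by (simp add: airy_right_def algebra_simps)
  also have "\<dots> = c * ((of_int (int k * int N) - of_nat (j + 1)) * airy_op N c d j k n - d * airy_op N c d (Suc j) k n)"
    unfolding airy_op_euler by (simp add: algebra_simps)
  also have "\<dots> = (c * of_nat N) * ((of_nat k - of_nat (j + 1) / of_nat N) * airy_op N c d j k n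
      - d / of_nat N * airy_op N c d (Suc j) k n)"
    using assms(1) by (simp add: field_simps)
  finally show ?thesis using assms by simp
qed

text \<open>Moves the origin of the exponents from -b to -K. The added terms vanish: at the lower
  end by the bound on X, at the upper end by the bound on \<beta>.\<close>

lemma sum_int_shift:
  fixes X :: "int \<Rightarrow> complex"
  assumes "b \<le> K" "\<And>k. k < - int b \<Longrightarrow> X k = 0" "\<And>s. s > Q + (K - b) \<Longrightarrow> \<beta> s = 0"
  shows "(\<Sum>k\<le>Q. X (int k - int b) * \<beta> (k + (K - b))) = (\<Sum>s\<le>Q + K. X (int s - int K) * \<beta> s)"
proof -
  have "(\<Sum>k\<le>Q. X (int k - int b) * \<beta> (k + (K - b))) = (\<Sum>s\<in>{K - b..Q + (K - b)}. X (int s - int K) * \<beta> s)"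
    by (rule sum.reindex_bij_witness[of _ "\<lambda>s. s - (K - b)" "\<lambda>k. k + (K - b)"])
       (use assms(1) in \<open>auto simp: of_nat_diff algebra_simps\<close>)
  also have "\<dots> = (\<Sum>s\<le>Q + K. X (int s - int K) * \<beta> s)"
  proof (rule sum.mono_neutral_left)
    show "\<forall>s\<in>{..Q + K} - {K - b..Q + (K - b)}. X (int s - int K) * \<beta> s = 0"
    proof
      fix s assume s: "s \<in> {..Q + K} - {K - b..Q + (K - b)}"
      then consider "s < K - b" | "s > Q + (K - b)" by force
      then show "X (int s - int K) * \<beta> s = 0"
        using assms by cases (auto intro!: assms(2))
    qed
  qed auto
  finally show ?thesis .
qed

section \<open>Hadamard's coefficients\<close>

lemma continuous_punctured_eq_0:
  fixes f :: "real \<Rightarrow> complex"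
  assumes "open J" "y \<in> J" "f differentiable (at y)" "\<And>x. x \<in> J \<Longrightarrow> x \<noteq> y \<Longrightarrow> f x = 0"
  shows "f y = 0"
proof -
  have "f \<midarrow>y\<rightarrow> f y"
    using differentiable_imp_continuous_within[OF assms(3)] by (simp add: continuous_within)
  moreover have "f \<midarrow>y\<rightarrow> 0"
    by (rule tendsto_eventually) (use assms(1,2,4) in \<open>auto simp: eventually_at_topological\<close>)
  ultimately show ?thesis by (rule tendsto_unique[OF trivial_limit_at])
qed

lemma heat_kernel_eq_0:
  "j > N - 2 \<Longrightarrow> heat_kernel N H j k x y = 0" "k < 0 \<Longrightarrow> heat_kernel N H j k x y = 0"
  by (auto simp: heat_kernel_def)

lemma H_op_alt:
  assumes "c = \<kappa> / of_nat N"
  shows "H_op N \<kappa> H y i x = pdo_pow_dx 0 i x + (\<Sum>j\<le>N - 2. Sum_any (\<lambda>k. if k = 0 then 0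
     else H j k x y * airy_op N c (of_real (x - y)) j k i))"
  unfolding H_op_def airy_op_eq assms power_divide by (simp only: mult.assoc)

text \<open>At order i only k \<le> j - i with j \<le> N - 2 can contribute, and Q covers all of
  these.\<close>

lemma H_op_eq_airy_sum:
  assumes "N \<ge> 2" "c = \<kappa> / of_nat N" "N - 2 \<le> R" "int Q \<ge> int N - i"
  shows "H_op N \<kappa> H y i x = airy_sum N c R Q (heat_kernel N H) y i x"
proof -
  let ?b = "\<lambda>j k. airy_op N c (of_real (x - y)) j k i"
  let ?f = "\<lambda>j k. if k = 0 then 0 else H j k x y * ?b j k"
  have "Sum_any (?f j) = sum (?f j) {..Q}" if "j \<le> N - 2" for j
  proof (rule Sum_any.expand_superset)
    show "{k. ?f j k \<noteq> 0} \<subseteq> {..Q}"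
    proof
      fix k assume "k \<in> {k. ?f j k \<noteq> 0}"
      then have "?b j k \<noteq> 0" by (auto split: if_splits)
      then have "i \<le> int j - int k" using airy_op_eq_0'[OF assms(1)] by (metis not_le)
      then show "k \<in> {..Q}" using that assms(1,4) by auto
    qed
  qed simp
  then have "H_op N \<kappa> H y i x = pdo_pow_dx 0 i x + (\<Sum>j\<le>N - 2. \<Sum>k\<le>Q. ?f j k)"
    by (simp add: H_op_alt[OF assms(2)])
  \<comment> \<open>The summand 1 is the image of the leading heat kernel term, j = k = 0.\<close>
  also have "pdo_pow_dx 0 i x = (\<Sum>j\<le>N - 2. if j = 0 then ?b 0 0 else 0)"
    by (simp add: pdo_pow_dx_def)
  also have "\<dots> + (\<Sum>j\<le>N - 2. \<Sum>k\<le>Q. ?f j k) = (\<Sum>j\<le>N - 2. \<Sum>k\<le>Q. heat_kernel N H j (int k) x y * ?b j k)"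
  proof -
    have "(if j = 0 then ?b 0 0 else 0) + (\<Sum>k\<le>Q. ?f j k) = (\<Sum>k\<le>Q. heat_kernel N H j (int k) x y * ?b j k)"
      if "j \<le> N - 2" for j
    proof -
      have "(if j = 0 then ?b 0 0 else 0) = (\<Sum>k\<le>Q. if k = 0 then (if j = 0 then ?b 0 0 else 0) else 0)"
        by simp
      then have "(if j = 0 then ?b 0 0 else 0) + (\<Sum>k\<le>Q. ?f j k)
          = (\<Sum>k\<le>Q. (if k = 0 then (if j = 0 then ?b 0 0 else 0) else 0) + ?f j k)"
        by (simp only: sum.distrib)
      also have "\<dots> = (\<Sum>k\<le>Q. heat_kernel N H j (int k) x y * ?b j k)"
        using that by (intro sum.cong refl) (auto simp: heat_kernel_def simp del: airy_op.simps)
      finally show ?thesis .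
    qed
    then show ?thesis
      by (subst sum.distrib[symmetric]) (rule sum.cong[OF refl], simp only: atMost_iff)
  qed
  also have "\<dots> = airy_sum N c R Q (heat_kernel N H) y i x"
    unfolding airy_sum_def
    using assms(3) by (intro sum.mono_neutral_left) (auto intro!: sum.neutral simp: heat_kernel_eq_0)
  finally show ?thesis .
qed

text \<open>The five facts run parallel to those of \<open>wave_function_product\<close>, so that
  the difference of the two operators satisfies the hypotheses of
  \<open>intertwiner_eq_0\<close>.\<close>

lemma hadamard_coeffs_intertwiner:
  fixes H :: "nat \<Rightarrow> nat \<Rightarrow> real \<Rightarrow> real \<Rightarrow> complex"
  assumes N: "N \<ge> 2" and \<kappa>: "\<kappa> ^ 2 = 1" and U: "open U" and H: "hadamard_coeffs_on U N \<kappa> u H"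
    and J: "J = {x. (x, y) \<in> U}" and u: "\<forall>i\<le>N - 2. inf_diff_on J (u i)"
  defines "G \<equiv> H_op N \<kappa> H y"
  shows "inf_diff_pdo J G"
    and "\<And>n x. x \<in> J \<Longrightarrow> L_act N u G n x = G (n - int N) x"
    and "\<And>i. y \<in> J \<Longrightarrow> (pdo_dx ^^ i) G (- 1) y = 0"
    and "\<And>m x. m > 0 \<Longrightarrow> G m x = 0"
    and "\<And>x. G 0 x = 1"
proof -
  define c where "c = \<kappa> / of_nat N"
  have c0: "c \<noteq> 0" using \<kappa> N by (auto simp: c_def)
  have oJ: "open J"
    unfolding J by (rule open_slice[OF U])
  let ?F = "heat_kernel N H"
  have F: "inf_diff_on J (\<lambda>x. ?F j k x y)" for j k
  proof (cases "j \<le> N - 2 \<and> 1 \<le> k \<and> \<not> (j = 0 \<and> k = 0)")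
    case True
    then have "smooth_on U (\<lambda>(x, y). H j (nat k) x y)"
      using H nat_mono[of 1 k] by (simp add: hadamard_coeffs_on_def)
    from smooth_on_slice[OF U this] show ?thesis using True by (simp add: heat_kernel_def J)
  next
    case False
    then have "(\<lambda>x. ?F j k x y) = (\<lambda>x. 1) \<or> (\<lambda>x. ?F j k x y) = (\<lambda>x. 0)"
      by (auto simp: heat_kernel_def fun_eq_iff)
    then show ?thesis by auto
  qed
  have G: "G m x = airy_sum N c R Q ?F y m x" if "N - 2 \<le> R" "int Q \<ge> int N - m" for R Q m x
    unfolding G_def by (rule H_op_eq_airy_sum[OF N c_def that])
  show Gsm: "inf_diff_pdo J G"
    unfolding inf_diff_pdo_def
  proof
    fix m
    have "G m = airy_sum N c (N - 2) (nat (int N - m)) ?F y m"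
      by (intro ext G) auto
    then show "inf_diff_on J (G m)"
      using inf_diff_pdo_airy_sum[where F = ?F, OF oJ F] by (simp add: inf_diff_pdo_def)
  qed
  have nonneg: "G m x = pdo_pow_dx 0 m x" if "m \<ge> 0" for m x
  proof -
    \<comment> \<open>The order j - k (N - 1) is negative as soon as j \<le> N - 2 and k \<ge>
      1.\<close>
    have "airy_op N c d j k m = 0" if "j \<le> N - 2" "k \<noteq> 0" for j k d
    proof (rule airy_op_eq_0)
      have "int j < 1 * (int N - 1)" using that(1) N by simp
      also have "\<dots> \<le> int k * (int N - 1)" using that N by (intro mult_right_mono) auto
      finally show "m > int j - int k * (int N - 1)" using \<open>m \<ge> 0\<close> by linarith
    qed
    then have "(\<Sum>j\<le>N - 2. Sum_any (\<lambda>k. if k = 0 then 0 else H j k x y * airy_op N c (of_real (x - y)) j k m)) = 0"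
      by (intro sum.neutral ballI) (simp cong: if_cong)
    then show ?thesis unfolding G_def H_op_alt[OF c_def] by simp
  qed
  show Gpos: "G m x = 0" if "m > 0" for m x
    using nonneg[of m x] that by (simp add: pdo_pow_dx_def)
  show "G 0 x = 1" for x
    using nonneg[of 0 x] by (simp add: pdo_pow_dx_def)
  show "(pdo_dx ^^ i) G (- 1) y = 0" if y: "y \<in> J" for i
  proof -
    let ?Q = "N + 1 + i"
    have "(pdo_dx ^^ i) G (- 1) y = (pdo_dx ^^ i) (airy_sum N c (N - 2 + i) ?Q ?F y) (- 1) y"
      by (rule pdo_dx_funpow_cong[OF oJ _ y]) (rule G, auto)
    also have "\<dots> = airy_sum N c (N - 2 + i) ?Q ((hk_dx ^^ i) ?F) y (- 1) y"
      by (rule pdo_dx_funpow_airy_sum[where F = ?F and r = "N - 2", OF oJ F _ _ y]) (auto simp: heat_kernel_eq_0)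
    also have "\<dots> = 0"
    proof -
      \<comment> \<open>For k = 0 the only order present is j \<ge> 0; for k \<ge> 1 both factors d
        and n + 1 in the recursion are 0.\<close>
      have "airy_op N c 0 j k (- 1) = 0" for j k by (cases k) auto
      then show ?thesis by (simp add: airy_sum_def)
    qed
    finally show ?thesis .
  qed
  define E where "E n x = L_act N u G n x - G (n - int N) x" for n x
  \<comment> \<open>R bounds the index j after N derivatives in x. K provides one factor
    \<open>D_N\<close> for each of at most R Airy reductions and one for the factor 1/t of the time
    derivative.\<close>
  define R where "R = 2 * N"
  define K where "K = Suc R"
  have hk_L_0: "hk_L N u ?F j k x y = 0" if "j > R \<or> k < 0" for j k x
  proof -
    have "(hk_dx ^^ i) ?F j k x y = 0" if "i \<le> N" for i
    proof (cases "k < 0")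
      case True
      then show ?thesis by (intro hk_dx_funpow_eq_0') (simp add: heat_kernel_eq_0)
    next
      case False
      then have "j > N - 2 + i" using \<open>j > R \<or> k < 0\<close> that by (auto simp: R_def)
      then show ?thesis
        by (intro hk_dx_funpow_eq_0[where r = "N - 2" and F = ?F]) (auto simp: heat_kernel_eq_0)
    qed
    then show ?thesis by (simp add: hk_L_def)
  qed
  have hk_dt_0: "hk_dt N ?F j k x y = 0" if "j > R \<or> k < - 1" for j k x
    using that N by (auto simp: hk_dt_def heat_kernel_eq_0 R_def)
  have right_0: "(airy_right N c (of_real (x - y)) ^^ K) (\<lambda>n. E n x) n = 0" if x: "x \<in> J" for n x
  proof -
    \<comment> \<open>Large enough for the cutoff to be exact at all orders from n - N on, and for
      the operator coefficients with j \<le> R and k > Q to vanish at order n.\<close>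
    define Q where "Q = nat (int R + int N - n)"
    let ?d = "complex_of_real (x - y)"
    let ?b = "\<lambda>j k. airy_op N c ?d j k n"
    let ?r = "airy_right N c ?d"
    have xU: "(x, y) \<in> U" using x by (simp add: J)
    have b0: "?b j k = 0" if "j \<le> R" "k > Q" for j k
      using that by (intro airy_op_eq_0'[OF N]) (auto simp: Q_def)
    have GA: "G m x' = airy_sum N c R Q ?F y m x'" if "m \<ge> n - int N" for m x'
      using that by (intro G) (auto simp: R_def Q_def)
    have L: "L_act N u G m x = airy_sum N c R Q (hk_L N u ?F) y m x" if "m \<ge> n" for m
    proof -
      have "L_act N u G m x = L_act N u (airy_sum N c R Q ?F y) m x"
        using that by (intro L_act_cong[OF oJ _ x] GA) auto
      also have "\<dots> = airy_sum N c R Q (hk_L N u ?F) y m x"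
        by (rule L_act_airy_sum[where F = ?F and r = "N - 2", OF oJ F _ _ x]) (auto simp: heat_kernel_eq_0 R_def)
      finally show ?thesis .
    qed
    let ?A = "{..R} \<times> {..Q}"
    let ?XL = "\<lambda>j k. hk_L N u ?F j k x y" and ?XT = "\<lambda>j k. \<kappa> * hk_dt N ?F j k x y"
    have 1: "(?r ^^ K) (\<lambda>m. L_act N u G m x) n = (\<Sum>j\<le>R. \<Sum>s\<le>Q + K. ?XL j (int s - int K) * ?b j s)"
    proof -
      have "(?r ^^ K) (\<lambda>m. L_act N u G m x) n
         = (?r ^^ K) (\<lambda>m. \<Sum>(j, k)\<in>?A. ?XL j (int k) * airy_op N c ?d j k m) n"
        using N by (intro airy_right_funpow_cong) (auto simp: L airy_sum_def sum.cartesian_product)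
      also have "\<dots> = (\<Sum>(j, k)\<in>?A. ?XL j (int k) * ?b j (k + K))"
        using airy_right_funpow_lincomb[where N = N and c = c and d = ?d and K = K and A = ?A
            and t = "\<lambda>(j, k). ?XL j (int k)" and P = "\<lambda>(j, k). airy_op N c ?d j k" and n = n]
        by (simp add: case_prod_unfold airy_right_funpow_airy_op)
      also have "\<dots> = (\<Sum>j\<le>R. \<Sum>k\<le>Q. ?XL j (int k) * ?b j (k + K))"
        by (simp only: sum.cartesian_product)
      also have "\<dots> = (\<Sum>j\<le>R. \<Sum>s\<le>Q + K. ?XL j (int s - int K) * ?b j s)"
      proof (rule sum.cong[OF refl])
        fix j assume "j \<in> {..R}"
        then show "(\<Sum>k\<le>Q. ?XL j (int k) * ?b j (k + K)) = (\<Sum>s\<le>Q + K. ?XL j (int s - int K) * ?b j s)"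
          using sum_int_shift[of 0 K "?XL j" Q "?b j"] hk_L_0 b0 by simp
      qed
      finally show ?thesis .
    qed
    have 2: "(?r ^^ K) (\<lambda>m. G (m - int N) x) n = (\<Sum>j\<le>R. \<Sum>s\<le>Q + K. ?XT j (int s - int K) * ?b j s)"
    proof -
      have "(?r ^^ K) (\<lambda>m. G (m - int N) x) n
         = (?r ^^ K) (\<lambda>m. \<Sum>(j, k)\<in>?A. ?F j (int k) x y * airy_op N c ?d j k (m - int N)) n"
        using N by (intro airy_right_funpow_cong) (auto simp: GA airy_sum_def sum.cartesian_product)
      \<comment> \<open>One of the K factors joins \<open>\<partial>^N\<close> to form \<kappa> t
        d/dt; the factor t is the reason for the exponent k - 1 in \<open>?XT\<close>.\<close>
      also have "\<dots> = (?r ^^ R) (?r (\<lambda>m. \<Sum>(j, k)\<in>?A. ?F j (int k) x y * airy_op N c ?d j k (m - int N))) n"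
        by (simp add: K_def funpow_swap1)
      also have "?r (\<lambda>m. \<Sum>(j, k)\<in>?A. ?F j (int k) x y * airy_op N c ?d j k (m - int N))
          = (\<lambda>m. \<Sum>(j, k)\<in>?A. ?XT j (int k - 1) * airy_op N c ?d j k m)"
      proof
        fix m
        let ?bm = "\<lambda>j k. airy_op N c ?d j k m"
        have "?r (\<lambda>m. \<Sum>(j, k)\<in>?A. ?F j (int k) x y * airy_op N c ?d j k (m - int N)) m
           = (\<Sum>(j, k)\<in>?A. ?F j (int k) x y * ?r (\<lambda>m. airy_op N c ?d j k (m - int N)) m)"
          using airy_right_funpow_lincomb[where N = N and c = c and d = ?d and K = 1 and A = ?A
              and t = "\<lambda>(j, k). ?F j (int k) x y"
              and P = "\<lambda>(j, k) m. airy_op N c ?d j k (m - int N)" and n = m]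
          by (simp add: case_prod_unfold)
        also have "\<dots> = (\<Sum>k\<le>Q. \<Sum>j\<le>R. ?F j (int k) x y * (\<kappa> * ((of_nat k - of_nat (j + 1) / of_nat N) * ?bm j k
            - ?d / of_nat N * ?bm (Suc j) k)))"
          using N by (subst sum.swap) (simp only: sum.cartesian_product airy_right_shift_airy_op[OF _ c_def])
        also have "\<dots> = (\<Sum>k\<le>Q. (\<Sum>j\<le>R. \<kappa> * ((of_nat k - of_nat (j + 1) / of_nat N) * ?F j (int k) x y) * ?bm j k)
            - \<kappa> * ?d / of_nat N * (\<Sum>j\<le>R. ?F j (int k) x y * ?bm (Suc j) k))"
          by (simp add: sum_subtractf[symmetric] sum_distrib_left algebra_simps)
        also have "\<dots> = (\<Sum>k\<le>Q. (\<Sum>j\<le>R. \<kappa> * ((of_nat k - of_nat (j + 1) / of_nat N) * ?F j (int k) x y) * ?bm j k)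
            - \<kappa> * ?d / of_nat N * (\<Sum>j\<le>R. (if j = 0 then 0 else ?F (j - 1) (int k) x y) * ?bm j k))"
        proof -
          have "?F R (int k) x y = 0" for k using N by (intro heat_kernel_eq_0) (simp add: R_def)
          then show ?thesis
            using sum_pred_shift[where f = "\<lambda>j. ?F j (int k) x y" and R = R and g = "\<lambda>j. ?bm j k" for k] by simp
        qed
        also have "\<dots> = (\<Sum>k\<le>Q. \<Sum>j\<le>R. ?XT j (int k - 1) * ?bm j k)"
          unfolding sum_distrib_left sum_subtractf[symmetric]
          by (intro sum.cong refl) (simp add: hk_dt_def algebra_simps)
        also have "\<dots> = (\<Sum>(j, k)\<in>?A. ?XT j (int k - 1) * ?bm j k)"
          by (subst sum.swap) (simp only: sum.cartesian_product)
        finally show "?r (\<lambda>m. \<Sum>(j, k)\<in>?A. ?F j (int k) x y * airy_op N c ?d j k (m - int N)) m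
          = (\<Sum>(j, k)\<in>?A. ?XT j (int k - 1) * ?bm j k)" .
      qed
      also have "(?r ^^ R) (\<lambda>m. \<Sum>(j, k)\<in>?A. ?XT j (int k - 1) * airy_op N c ?d j k m) n
          = (\<Sum>(j, k)\<in>?A. ?XT j (int k - 1) * ?b j (k + R))"
        using airy_right_funpow_lincomb[where N = N and c = c and d = ?d and K = R and A = ?A
            and t = "\<lambda>(j, k). ?XT j (int k - 1)" and P = "\<lambda>(j, k). airy_op N c ?d j k" and n = n]
        by (simp add: case_prod_unfold airy_right_funpow_airy_op)
      also have "\<dots> = (\<Sum>j\<le>R. \<Sum>k\<le>Q. ?XT j (int k - 1) * ?b j (k + R))"
        by (simp only: sum.cartesian_product)
      also have "\<dots> = (\<Sum>j\<le>R. \<Sum>s\<le>Q + K. ?XT j (int s - int K) * ?b j s)"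
      proof (rule sum.cong[OF refl])
        fix j assume "j \<in> {..R}"
        then show "(\<Sum>k\<le>Q. ?XT j (int k - 1) * ?b j (k + R)) = (\<Sum>s\<le>Q + K. ?XT j (int s - int K) * ?b j s)"
          using sum_int_shift[of 1 K "?XT j" Q "?b j"] hk_dt_0 b0 by (simp add: K_def)
      qed
      finally show ?thesis .
    qed
    have van: "?b j s = 0" if "j \<le> N - 2" "s > Q + K - R" for j s
      using that by (intro b0) (auto simp: K_def R_def)
    have red: "(\<Sum>i\<le>R. \<Sum>p\<le>R. ?XL i (k + int p) * airy_coeff N \<kappa> ?d p i j)
        = (\<Sum>i\<le>R. \<Sum>p\<le>R. ?XT i (k + int p) * airy_coeff N \<kappa> ?d p i j)" if "j \<le> N - 2" for j k
    proof -
      have "hk_reduce N \<kappa> (hk_dt N ?F) j k x y = \<kappa> * hk_reduce N \<kappa> (hk_L N u ?F) j k x y"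
      proof -
        have "\<forall>(x, y)\<in>U. hk_reduce N \<kappa> (hk_dt N ?F) j k x y = \<kappa> * hk_reduce N \<kappa> (hk_L N u ?F) j k x y"
          using H that unfolding hadamard_coeffs_on_def by blast
        from bspec[OF this xU] show ?thesis by simp
      qed
      \<comment> \<open>As \<kappa> squared is 1, the factor can be moved to the time derivative,
        where the operator side has it.\<close>
      then have "\<kappa> * hk_reduce N \<kappa> (hk_dt N ?F) j k x y = hk_reduce N \<kappa> (hk_L N u ?F) j k x y"
        using \<kappa> by (simp add: mult.assoc[symmetric] power2_eq_square)
      moreover have "hk_reduce N \<kappa> (hk_L N u ?F) j k x y = (\<Sum>i\<le>R. \<Sum>p\<le>R. ?XL i (k + int p) * airy_coeff N \<kappa> ?d p i j)"
        by (rule hk_reduce_eq[OF N]) (simp add: hk_L_0)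
      moreover have "hk_reduce N \<kappa> (hk_dt N ?F) j k x y = (\<Sum>i\<le>R. \<Sum>p\<le>R. hk_dt N ?F i (k + int p) x y * airy_coeff N \<kappa> ?d p i j)"
        by (rule hk_reduce_eq[OF N]) (simp add: hk_dt_0)
      ultimately show ?thesis by (simp add: sum_distrib_left mult.assoc del: of_real_diff)
    qed
    have RK: "R + 1 \<le> K" "R + 0 \<le> K" "R \<le> Q + K" by (simp_all add: K_def)
    \<comment> \<open>After reduction both sums run over j \<le> N - 2, and there the heat equation
      identifies the coefficients. The lowest exponent is 0 for L and -1 for the time derivative,
      hence b = 0 and b = 1.\<close>
    have "(\<Sum>j\<le>R. \<Sum>s\<le>Q + K. ?XL j (int s - int K) * ?b j s) = (\<Sum>j\<le>R. \<Sum>s\<le>Q + K. ?XT j (int s - int K) * ?b j s)"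
      using airy_op_reduce_sum[where X = ?XL and b = 0, OF N c_def _ RK(2,3) van]
        airy_op_reduce_sum[where X = ?XT and b = 1, OF N c_def _ RK(1,3) van] hk_L_0 hk_dt_0
      by (simp add: red del: of_real_diff)
    then show ?thesis unfolding E_def airy_right_funpow_diff 1 2 by simp
  qed
  have E_pos: "E n x = 0" if "n > int N" "x \<in> J" for n x
  proof -
    \<comment> \<open>At the orders that L can see, G agrees with 0, written as an empty linear
      combination.\<close>
    have "L_act N u G n x = L_act N u (\<lambda>m x. \<Sum>p\<in>({} :: nat set). 0 * G m x) n x"
      by (rule L_act_cong[OF oJ _ that(2)]) (use that(1) in \<open>auto intro!: Gpos\<close>)
    also have "\<dots> = 0" by (subst L_act_lincomb[OF oJ _ that(2)]) auto
    finally show ?thesis using Gpos[of "n - int N" x] that(1) by (simp add: E_def)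
  qed
  have E_off: "E n x = 0" if "x \<in> J" "x \<noteq> y" for n x
  proof (rule airy_right_funpow_eq_0D[where P = "\<lambda>n. E n x"])
    show "1 \<le> N" "c \<noteq> 0" "complex_of_real (x - y) \<noteq> 0" using N c0 that(2) by simp_all
    show "E n x = 0" if "n > int N" for n using E_pos that \<open>x \<in> J\<close> by blast
    show "(airy_right N c (of_real (x - y)) ^^ K) (\<lambda>n. E n x) n = 0" for n by (rule right_0[OF that(1)])
  qed
  have E: "E n x = 0" if "x \<in> J" for n x
  proof (cases "x = y")
    case True
    \<comment> \<open>Differentiability of \<open>E n\<close> on J extends its vanishing from x
      \<noteq> y to x = y.\<close>
    have "inf_diff_on J ((pdo_dx ^^ i) G n)" for i
      using inf_diff_pdo_dx_funpow[OF oJ Gsm] by (simp add: inf_diff_pdo_def)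
    then have "inf_diff_on J (\<lambda>x. L_act N u G n x + (- 1) * G (n - int N) x)"
      unfolding L_act_def using u Gsm
      by (intro inf_diff_on_add[OF oJ] inf_diff_on_sum[OF oJ] inf_diff_on_mult[OF oJ] inf_diff_on_const)
         (auto simp: inf_diff_pdo_def)
    then have "inf_diff_on J (\<lambda>x. E n x)" by (simp add: E_def)
    then show ?thesis
      using continuous_punctured_eq_0[OF oJ that, of "E n"] E_off that True inf_diff_on_differentiable by auto
  qed (use E_off that in blast)
  show "L_act N u G n x = G (n - int N) x" if "x \<in> J" for n x
    using E[OF that, of n] by (simp add: E_def)
qed

section \<open>Comparison of the heat kernel operator with the product of wave functions\<close>

theorem theorem4p2:
  fixes N :: nat and \<kappa> :: complex
    and I :: "real set" and U :: "(real \<times> real) set"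
    and u :: "nat \<Rightarrow> real \<Rightarrow> complex"
    and H :: "nat \<Rightarrow> nat \<Rightarrow> real \<Rightarrow> real \<Rightarrow> complex"
    and S T :: pdo
  assumes "N \<ge> 2"
    and "open I" and "is_interval I"
    and "\<forall>i\<le>N - 2. smooth_on I (u i)"
    and "even N \<Longrightarrow> \<kappa> = (-1) ^ (N div 2 + 1)"
    and "odd N \<Longrightarrow> \<kappa> \<in> {1, -1}"
    and "diagonal_nhd I U"
    and "hadamard_coeffs_on U N \<kappa> u H"
    and "wave_operator_on I N u S"
    and "pdo_inverse_on I (pdo_adjoint S) T"
  shows "\<forall>y\<in>I. pdo_eq_on {x. (x, y) \<in> U} (H_op N \<kappa> H y) (pdo_series (\<lambda>n x. omega S T n x y))"
proof
  fix y assume y: "y \<in> I"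
  define J where "J = {x. (x, y) \<in> U}"
  have U: "open U" and JI: "J \<subseteq> I" and yJ: "y \<in> J" and iJ: "is_interval J"
    using assms(7) y by (auto simp: diagonal_nhd_def J_def)
  have oJ: "open J"
    unfolding J_def by (rule open_slice[OF U])
  have \<kappa>: "\<kappa> ^ 2 = 1"
    using assms(5,6) by (cases "even N") (auto simp: power_mult[symmetric] mult.commute)
  have u: "\<forall>i\<le>N - 2. inf_diff_on J (u i)"
    using assms(2,4) JI by (blast intro: inf_diff_on_subset smooth_on_imp_inf_diff_on)
  define G where "G = H_op N \<kappa> H y"
  define W where "W = pdo_series (\<lambda>n x. omega S T n x y)"
  note G = hadamard_coeffs_intertwiner[OF assms(1) \<kappa> U assms(8) J_def u, folded G_def]
  note W = wave_function_product[OF assms(1,2,9,10) y, folded W_def]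
  have Wsm: "inf_diff_pdo J W" using W(1) JI by (auto simp: inf_diff_pdo_def intro: inf_diff_on_subset)
  \<comment> \<open>The difference G - W, written as a sum over \<open>bool\<close> so that the
    lemmas on linear combinations apply.\<close>
  define P where "P = (\<lambda>m x. \<Sum>b\<in>(UNIV :: bool set). (if b then 1 else - 1) * (if b then G else W) m x)"
  have P: "P m x = G m x - W m x" for m x by (simp add: P_def UNIV_bool)
  have GW: "inf_diff_pdo J (if b then G else W)" for b using G(1) Wsm by simp
  have lin: "(pdo_dx ^^ i) P n x = (pdo_dx ^^ i) G n x - (pdo_dx ^^ i) W n x"
    "L_act N u P n x = L_act N u G n x - L_act N u W n x" if "x \<in> J" for i n x
    unfolding P_def
    by (subst pdo_dx_funpow_lincomb[OF oJ GW that], simp add: UNIV_bool)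
       (subst L_act_lincomb[OF oJ GW that], simp add: UNIV_bool)
  have "P n x = 0" if x: "x \<in> J" for n x
  \<comment> \<open>The slice J is an interval containing y, so the values at y determine the
    constants of integration on all of J.\<close>
  proof (rule intertwiner_eq_0[OF assms(1) oJ iJ yJ])
    show "inf_diff_pdo J P"
      unfolding P_def inf_diff_pdo_def using GW
      by (intro allI inf_diff_on_sum[OF oJ] inf_diff_on_mult[OF oJ] inf_diff_on_const) (simp add: inf_diff_pdo_def)
    show "L_act N u P n x = P (n - int N) x" if "x \<in> J" for n x
      using lin(2)[OF that] G(2)[OF that] W(2)[of x] that JI by (auto simp: P)
    show "(pdo_dx ^^ i) P (- 1) y = 0" for i
      using lin(1)[OF yJ] G(3)[OF yJ] W(3) by simp
    show "P m x = 0" if "m \<ge> 0" "x \<in> J" for m x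
    proof (cases "m = 0")
      case True
      then show ?thesis using G(5) W(5)[of x] that JI by (auto simp: P)
    next
      case False
      then show ?thesis using G(4)[of m x] W(4)[of m x] that by (simp add: P)
    qed
  qed (rule x)
  then show "pdo_eq_on {x. (x, y) \<in> U} (H_op N \<kappa> H y) (pdo_series (\<lambda>n x. omega S T n x y))"
    unfolding pdo_eq_on_def J_def[symmetric] G_def[symmetric] W_def[symmetric] by (simp add: P)
qed

end
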